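(* Assume the setting described in the context. Let $\mathbf{x}=\mathbf{A}^{-1}\mathbf{b}$, and assume that the error propagation matrix $\mathbf{E}$ of the exV-cycle method satisfies $\|\mathbf{E}\|_{\mathbf{A}}<1$. Let $\mathbf{x}^{\mathrm{prev}}\in\mathbb{R}^{n}$, let $\mathbf{x}^{\mathrm{new}}_{\mathrm{ex}}$ be the approximation computed by one iteration of the exV-cycle method starting from $\mathbf{x}^{\mathrm{prev}}$, and let $\mathbf{x}^{\mathrm{new}}_{\mathrm{in}}$ be the approximation computed by one iteration of the inV-cycle method starting from the same $\mathbf{x}^{\mathrm{prev}}$. Assume that the error $\mathbf{v}_0-\mathbf{v}_{0,\mathrm{in}}$ of the coarsest-level solver in this iteration satisfies $$\|\mathbf{v}_0-\mathbf{v}_{0,\mathrm{in}}\|_{\mathbf{A}_0}\le\gamma\,\|\mathbf{x}-\mathbf{x}^{\mathrm{prev}}\|_{\mathbf{A}}\qquad( * )$$ for some constant $\gamma>0$. Then (for $\mathbf{x}^{\mathrm{prev}}\neq\mathbf{x}$) $$\frac{\|\mathbf{x}^{\mathrm{new}}_{\mathrm{ex}}-\mathbf{x}^{\mathrm{new}}_{\mathrm{in}}\|_{\mathbf{A}}}{\|\mathbf{x}-\mathbf{x}^{\mathrm{prev}}\|_{\mathbf{A}}}\le\|\mathbf{S}\|_{\mathbf{A}_0,\mathbf{A}}\,\gamma,$$ where the matrix $\mathbf{S}$ (defined in the context) satisfies $\|\mathbf{S}\|_{\mathbf{A}_0,\mathbf{A}}\le 1$. Moreover, $$\|\mathbf{x}-\mathbf{x}^{\mathrm{new}}_{\mathrm{in}}\|_{\mathbf{A}}\le\left(\|\mathbf{E}\|_{\mathbf{A}}+\|\mathbf{S}\|_{\mathbf{A}_0,\mathbf{A}}\,\gamma\right)\|\mathbf{x}-\mathbf{x}^{\mathrm{prev}}\|_{\mathbf{A}},$$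 and if the error of the coarsest-level solver satisfies $( * )$ (in every iteration, i.e. for every previous approximation $\mathbf{x}^{\mathrm{prev}}$, with one and the same constant $\gamma$) with $\gamma$ such that $$\|\mathbf{E}\|_{\mathbf{A}}+\|\mathbf{S}\|_{\mathbf{A}_0,\mathbf{A}}\,\gamma<1,$$ then the inV-cycle method converges, i.e. for any initial approximation its iterates converge to $\mathbf{x}$.
   Context: Setting. $\mathbf{A}\in\mathbb{R}^{n\times n}$ is symmetric positive definite (SPD) and $\mathbf{b}\in\mathbb{R}^n$. There are $J+1$ levels $0,\dots,J$ ($J\ge1$; level $0$ is the coarsest, level $J$ the finest), with system matrices $\mathbf{A}_j\in\mathbb{R}^{n_j\times n_j}$, $n_J=n$, $\mathbf{A}_J=\mathbf{A}$, and prolongation matrices $\mathbf{P}_j\in\mathbb{R}^{n_j\times n_{j-1}}$, $j=1,\dots,J$, of full (column) rank, satisfying the Galerkin condition $\mathbf{A}_{j-1}=\mathbf{P}_j^\top\mathbf{A}_j\mathbf{P}_j$ for $j=1,\dots,J$ (so all $\mathbf{A}_j$ are SPD). $\mathbf{I}_j\in\mathbb{R}^{n_j\times n_j}$ is the identity. Norms. $\|\cdot\|$ is the Euclidean norm, $\|\mathbf{v}\|_{\mathbf{A}_j}=\|\mathbf{A}_j^{1/2}\mathbf{v}\|$; the same symbols denote the induced matrix norms. For $\mathbf{S}\in\mathbb{R}^{n_J\times n_0}$, $\|\mathbf{S}\|_{\mathbf{A}_0,\mathbf{A}}=\max_{\mathbf{v}\in\mathbb{R}^{n_0},\,\mathbf{v}\ne\mathbf{0}}\|\mathbf{S}\mathbf{v}\|_{\mathbf{A}}/\|\mathbf{v}\|_{\mathbf{A}_0}$.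 Smoothers. $\mathbf{M}_j,\mathbf{N}_j\in\mathbb{R}^{n_j\times n_j}$, $j=1,\dots,J$, are non-singular matrices (not necessarily symmetric) with $\|\mathbf{I}_j-\mathbf{M}_j\mathbf{A}_j\|_{\mathbf{A}_j}<1$ and $\|\mathbf{I}_j-\mathbf{N}_j\mathbf{A}_j\|_{\mathbf{A}_j}<1$. Also allowed: no pre-smoothing (all $\mathbf{M}_j=\mathbf{0}$, with the $\mathbf{N}_j$ non-singular and satisfying $\|\mathbf{I}_j-\mathbf{N}_j\mathbf{A}_j\|_{\mathbf{A}_j}<1$) or no post-smoothing (all $\mathbf{N}_j=\mathbf{0}$, with the $\mathbf{M}_j$ non-singular and satisfying $\|\mathbf{I}_j-\mathbf{M}_j\mathbf{A}_j\|_{\mathbf{A}_j}<1$). V-cycle. One iteration maps $\mathbf{x}^{\mathrm{prev}}$ to $\mathbf{x}^{\mathrm{new}}=\mathbf{V}(\mathbf{b},\mathbf{x}^{\mathrm{prev}},J)$, where $\mathbf{V}(\mathbf{f}_j,\mathbf{v}_j^{[0]},j)$ is defined recursively. For $j\ne0$: $\mathbf{v}_j^{[1]}=\mathbf{v}_j^{[0]}+\mathbf{M}_j(\mathbf{f}_j-\mathbf{A}_j\mathbf{v}_j^{[0]})$; $\mathbf{f}_{j-1}=\mathbf{P}_j^\top(\mathbf{f}_j-\mathbf{A}_j\mathbf{v}_j^{[1]})$; $\mathbf{v}_{j-1}^{[2]}=\mathbf{V}(\mathbf{f}_{j-1},\mathbf{0},j-1)$; $\mathbf{v}_j^{[3]}=\mathbf{v}_j^{[1]}+\mathbf{P}_j\mathbf{v}_{j-1}^{[2]}$;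 $\mathbf{v}_j^{[4]}=\mathbf{v}_j^{[3]}+\mathbf{N}_j(\mathbf{f}_j-\mathbf{A}_j\mathbf{v}_j^{[3]})$; return $\mathbf{v}_j^{[4]}$. For $j=0$: return an exact or approximate solution of $\mathbf{A}_0\mathbf{v}_0=\mathbf{f}_0$. In the exV-cycle method the exact solution $\mathbf{v}_0=\mathbf{A}_0^{-1}\mathbf{f}_0$ is returned; in the inV-cycle method an approximation $\mathbf{v}_{0,\mathrm{in}}\in\mathbb{R}^{n_0}$, computed by an arbitrary (possibly nonlinear) solver, is returned. For the same $\mathbf{x}^{\mathrm{prev}}$ both methods produce the same $\mathbf{f}_0$, hence $\mathbf{v}_0$ is the same. All other computations are exact. Error propagation matrix. $\mathbf{E}\in\mathbb{R}^{n\times n}$ is the matrix, independent of $\mathbf{b}$ and $\mathbf{x}^{\mathrm{prev}}$, for which one exV-cycle iteration satisfies $\mathbf{x}-\mathbf{x}^{\mathrm{new}}_{\mathrm{ex}}=\mathbf{E}(\mathbf{x}-\mathbf{x}^{\mathrm{prev}})$ for all $\mathbf{b}$ and $\mathbf{x}^{\mathrm{prev}}$, with $\mathbf{x}=\mathbf{A}^{-1}\mathbf{b}$. Matrix $\mathbf{S}$. $\mathbf{S}=(\mathbf{I}_J-\mathbf{N}_J\mathbf{A}_J)\mathbf{P}_J\cdots(\mathbf{I}_1-\mathbf{N}_1\mathbf{A}_1)\mathbf{P}_1\in\mathbb{R}^{n_J\times n_0}$. *)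

theory Defs
  imports
    Complex_Main
    "Jordan_Normal_Form.Matrix"
    "Jordan_Normal_Form.Gauss_Jordan_Elimination"
    "Jordan_Normal_Form.DL_Rank"
begin

abbreviation matinv :: "real mat \<Rightarrow> real mat" where
  "matinv A \<equiv> the (mat_inverse A)"

definition spd :: "real mat \<Rightarrow> bool" where
  "spd A \<longleftrightarrow> square_mat A \<and> transpose_mat A = A \<and>
     (\<forall>v \<in> carrier_vec (dim_row A). v \<noteq> 0\<^sub>v (dim_row A) \<longrightarrow> v \<bullet> (A *\<^sub>v v) > 0)"

(* An SPD matrix has exactly one SPD square root, so the choice is immaterial. *)
definition spd_sqrt :: "real mat \<Rightarrow> real mat" where
  "spd_sqrt A = (SOME B. spd B \<and> B \<in> carrier_mat (dim_row A) (dim_row A) \<and> B * B = A)"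

definition eucl_norm :: "real vec \<Rightarrow> real" where
  "eucl_norm v = sqrt (v \<bullet> v)"

definition energy_norm :: "real mat \<Rightarrow> real vec \<Rightarrow> real" where
  "energy_norm A v = eucl_norm (spd_sqrt A *\<^sub>v v)"

(* The norm of S from (R^c, energy norm of B) to (R^r, energy norm of C), where S is r x c; for
   SPD B and C and c > 0 the supremum is attained, i.e. it is the maximum. *)
definition op_norm :: "real mat \<Rightarrow> real mat \<Rightarrow> real mat \<Rightarrow> real" where
  "op_norm B C S =
     (SUP v \<in> {v \<in> carrier_vec (dim_col S). v \<noteq> 0\<^sub>v (dim_col S)}.
        energy_norm C (S *\<^sub>v v) / energy_norm B v)"

(* Throughout, n j is the number of unknowns on level j; level 0 is the coarsest one. The matrix
   P j maps level j - 1 to level j, so P, M and N are only meaningful for indices j >= 1. *)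

definition convergent_smoother :: "nat \<Rightarrow> (nat \<Rightarrow> nat) \<Rightarrow> (nat \<Rightarrow> real mat) \<Rightarrow> (nat \<Rightarrow> real mat) \<Rightarrow> bool" where
  "convergent_smoother J n A M \<longleftrightarrow>
     (\<forall>j \<in> {1..J}. M j \<in> carrier_mat (n j) (n j) \<and> invertible_mat (M j) \<and>
        op_norm (A j) (A j) (1\<^sub>m (n j) - M j * A j) < 1)"

definition no_smoother :: "nat \<Rightarrow> (nat \<Rightarrow> nat) \<Rightarrow> (nat \<Rightarrow> real mat) \<Rightarrow> bool" where
  "no_smoother J n M \<longleftrightarrow> (\<forall>j \<in> {1..J}. M j = 0\<^sub>m (n j) (n j))"

(* vcycle n A P M N sol j f v is one V-cycle on level j with right-hand side f and initial
   approximation v, where sol maps a coarsest-level right-hand side to the vector that the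
   coarsest-level solver returns for it. *)
primrec vcycle :: "(nat \<Rightarrow> nat) \<Rightarrow> (nat \<Rightarrow> real mat) \<Rightarrow> (nat \<Rightarrow> real mat) \<Rightarrow> (nat \<Rightarrow> real mat) \<Rightarrow>
    (nat \<Rightarrow> real mat) \<Rightarrow> (real vec \<Rightarrow> real vec) \<Rightarrow> nat \<Rightarrow> real vec \<Rightarrow> real vec \<Rightarrow> real vec" where
  "vcycle n A P M N sol 0 f v = sol f"
| "vcycle n A P M N sol (Suc j) f v =
     (let v1 = v + M (Suc j) *\<^sub>v (f - A (Suc j) *\<^sub>v v);
          f' = transpose_mat (P (Suc j)) *\<^sub>v (f - A (Suc j) *\<^sub>v v1);
          v2 = vcycle n A P M N sol j f' (0\<^sub>v (n j));
          v3 = v1 + P (Suc j) *\<^sub>v v2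
      in v3 + N (Suc j) *\<^sub>v (f - A (Suc j) *\<^sub>v v3))"

(* The right-hand side f0 with which vcycle calls the coarsest-level solver; it is determined by
   the descending half of the cycle alone, hence depends neither on N nor on the solver. *)
primrec coarse_rhs :: "(nat \<Rightarrow> nat) \<Rightarrow> (nat \<Rightarrow> real mat) \<Rightarrow> (nat \<Rightarrow> real mat) \<Rightarrow> (nat \<Rightarrow> real mat) \<Rightarrow>
    nat \<Rightarrow> real vec \<Rightarrow> real vec \<Rightarrow> real vec" where
  "coarse_rhs n A P M 0 f v = f"
| "coarse_rhs n A P M (Suc j) f v =
     (let v1 = v + M (Suc j) *\<^sub>v (f - A (Suc j) *\<^sub>v v);
          f' = transpose_mat (P (Suc j)) *\<^sub>v (f - A (Suc j) *\<^sub>v v1)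
      in coarse_rhs n A P M j f' (0\<^sub>v (n j)))"

definition exact_solver :: "(nat \<Rightarrow> real mat) \<Rightarrow> real vec \<Rightarrow> real vec" where
  "exact_solver A f = matinv (A 0) *\<^sub>v f"

definition error_propagation_matrix :: "nat \<Rightarrow> (nat \<Rightarrow> nat) \<Rightarrow> (nat \<Rightarrow> real mat) \<Rightarrow>
    (nat \<Rightarrow> real mat) \<Rightarrow> (nat \<Rightarrow> real mat) \<Rightarrow> (nat \<Rightarrow> real mat) \<Rightarrow> real mat" where
  "error_propagation_matrix J n A P M N =
     (THE E. E \<in> carrier_mat (n J) (n J) \<and>
        (\<forall>b \<in> carrier_vec (n J). \<forall>y \<in> carrier_vec (n J).
           matinv (A J) *\<^sub>v b - vcycle n A P M N (exact_solver A) J b y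
             = E *\<^sub>v (matinv (A J) *\<^sub>v b - y)))"

primrec smoothed_prolongation :: "(nat \<Rightarrow> nat) \<Rightarrow> (nat \<Rightarrow> real mat) \<Rightarrow> (nat \<Rightarrow> real mat) \<Rightarrow>
    (nat \<Rightarrow> real mat) \<Rightarrow> nat \<Rightarrow> real mat" where
  "smoothed_prolongation n A P N 0 = 1\<^sub>m (n 0)"
| "smoothed_prolongation n A P N (Suc j) =
     (1\<^sub>m (n (Suc j)) - N (Suc j) * A (Suc j)) * P (Suc j) * smoothed_prolongation n A P N j"

(* The error bound on the coarsest level for an iteration started from y. *)
definition coarse_error_bound :: "nat \<Rightarrow> (nat \<Rightarrow> nat) \<Rightarrow> (nat \<Rightarrow> real mat) \<Rightarrow> (nat \<Rightarrow> real mat) \<Rightarrow>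
    (nat \<Rightarrow> real mat) \<Rightarrow> real vec \<Rightarrow> (real vec \<Rightarrow> real vec) \<Rightarrow> real \<Rightarrow> real vec \<Rightarrow> bool" where
  "coarse_error_bound J n A P M b sol \<gamma> y \<longleftrightarrow>
     (let f0 = coarse_rhs n A P M J b y
      in energy_norm (A 0) (exact_solver A f0 - sol f0)
           \<le> \<gamma> * energy_norm (A J) (matinv (A J) *\<^sub>v b - y))"

(* The coarsest-level solver may be nonlinear and may also depend on the iteration number and on
   the current approximation: sol k y is the solver used in iteration k when that iteration
   starts from y. *)
primrec inV_iterates :: "nat \<Rightarrow> (nat \<Rightarrow> nat) \<Rightarrow> (nat \<Rightarrow> real mat) \<Rightarrow> (nat \<Rightarrow> real mat) \<Rightarrow>
    (nat \<Rightarrow> real mat) \<Rightarrow> (nat \<Rightarrow> real mat) \<Rightarrow> real vec \<Rightarrow> (nat \<Rightarrow> real vec \<Rightarrow> real vec \<Rightarrow> real vec) \<Rightarrow>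
    real vec \<Rightarrow> nat \<Rightarrow> real vec" where
  "inV_iterates J n A P M N b sol x0 0 = x0"
| "inV_iterates J n A P M N b sol x0 (Suc k) =
     (let y = inV_iterates J n A P M N b sol x0 k
      in vcycle n A P M N (sol k y) J b y)"

end

(* The exact and the inexact cycle run through the same descending half, so they differ only by the
   coarse solution; prolonging and post-smoothing are affine, hence the final difference is S applied
   to the coarsest-level error. By the Galerkin condition each prolongation is an isometry for the
   energy norms, and each post-smoothing step is nonexpansive, so S has norm at most 1. The triangle
   inequality through the exact cycle, whose error map is the linear map E, gives the contraction
   factor and thus convergence.

   The energy norm is defined through the SPD square root, whose existence is proved by induction on
   the dimension: a Householder reflection taking a unit eigenvector to the first unit vector splits
   off a 1 x 1 block. *)
theory Submission
  imports Defs "Jordan_Normal_Form.Char_Poly" "HOL-Analysis.L2_Norm"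
    "HOL-Computational_Algebra.Fundamental_Theorem_Algebra"
begin

section \<open>Square roots of SPD matrices\<close>

text \<open>Three notions of the statement say nothing until a side condition is discharged:
  \<open>spd_sqrt\<close> is chosen by \<open>SOME\<close> and needs the existence of a root,
  \<open>error_propagation_matrix\<close> is chosen by \<open>THE\<close> and needs existence and
  uniqueness, and \<open>op_norm\<close> is a supremum of reals, usable only if its quotients are
  bounded above and some nonzero vector exists. Much of the development serves these obligations.
  Once a root exists, \<open>energy_norm A v\<close> is the square root of
  \<open>v \<bullet> (A *\<^sub>v v)\<close>, the form in which the Galerkin condition acts. To see
  that the error map of the exact cycle is a matrix, the right-hand side is written as
  \<open>A j *\<^sub>v x\<close> on every level: the restricted residual is again of this form, with
  the exact coarse correction in place of x. An arbitrary solver enters the comparison only through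
  its value at the coarse right-hand side that both cycles share.\<close>

lemma mult_unit_vec_index:
  fixes A :: "real mat"
  assumes "A \<in> carrier_mat m n" "i < m" "j < n"
  shows "(A *\<^sub>v unit_vec n j) $ i = A $$ (i, j)"
  using assms by (simp add: scalar_prod_right_unit)

lemma mat_eq_by_mult_vec:
  fixes A B :: "real mat"
  assumes A: "A \<in> carrier_mat m n" and B: "B \<in> carrier_mat m n"
    and eq: "\<And>v. v \<in> carrier_vec n \<Longrightarrow> A *\<^sub>v v = B *\<^sub>v v"
  shows "A = B"
proof (rule eq_matI)
  fix i j assume ij: "i < dim_row B" "j < dim_col B"
  have "A $$ (i, j) = (A *\<^sub>v unit_vec n j) $ i"
    using A B ij by (intro mult_unit_vec_index[symmetric]) auto
  also have "\<dots> = (B *\<^sub>v unit_vec n j) $ i" by (simp add: eq)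
  also have "\<dots> = B $$ (i, j)"
    using A B ij by (intro mult_unit_vec_index) auto
  finally show "A $$ (i, j) = B $$ (i, j)" .
qed (use A B in auto)

lemma scalar_prod_self_nonneg: "v \<bullet> v \<ge> (0 :: real)"
  unfolding scalar_prod_def by (intro sum_nonneg) simp

lemma scalar_prod_self_eq_0_iff:
  fixes v :: "real vec"
  assumes "v \<in> carrier_vec n"
  shows "v \<bullet> v = 0 \<longleftrightarrow> v = 0\<^sub>v n"
proof
  assume "v \<bullet> v = 0"
  hence "\<forall>i\<in>{0..<dim_vec v}. v $ i * v $ i = 0"
    unfolding scalar_prod_def by (subst (asm) sum_nonneg_eq_0_iff) auto
  thus "v = 0\<^sub>v n" using assms by (intro eq_vecI) auto
qed (use assms in auto)

lemma symmetric_scalar_prod: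
  fixes A :: "real mat"
  assumes A: "A \<in> carrier_mat n n" and sym: "transpose_mat A = A"
    and v: "v \<in> carrier_vec n" and w: "w \<in> carrier_vec n"
  shows "(A *\<^sub>v w) \<bullet> v = w \<bullet> (A *\<^sub>v v)"
  using transpose_vec_mult_scalar[OF A v w] sym by simp

lemma spdI:
  assumes "A \<in> carrier_mat n n" "transpose_mat A = A"
    "\<And>v. v \<in> carrier_vec n \<Longrightarrow> v \<noteq> 0\<^sub>v n \<Longrightarrow> v \<bullet> (A *\<^sub>v v) > 0"
  shows "spd A"
  using assms unfolding spd_def by auto

lemma spd_pos:
  assumes "spd A" "A \<in> carrier_mat n n" "v \<in> carrier_vec n" "v \<noteq> 0\<^sub>v n"
  shows "v \<bullet> (A *\<^sub>v v) > 0"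
  using assms unfolding spd_def by auto

lemma spd_symmetric: "spd A \<Longrightarrow> transpose_mat A = A"
  unfolding spd_def by auto

text \<open>Moving W across the scalar product gives the quadratic form of A at W v, and injectivity
  keeps W v nonzero. It serves both the conjugation by a reflection in the square root and the
  Galerkin product with a prolongation.\<close>

lemma spd_congruence:
  assumes A: "A \<in> carrier_mat n n" "spd A" and W: "W \<in> carrier_mat n m"
    and inj: "\<And>v. v \<in> carrier_vec m \<Longrightarrow> W *\<^sub>v v = 0\<^sub>v n \<Longrightarrow> v = 0\<^sub>v m"
  shows "spd (transpose_mat W * A * W)"
proof (rule spdI[of _ m])
  show "transpose_mat W * A * W \<in> carrier_mat m m" using A W by simp
  show "transpose_mat (transpose_mat W * A * W) = transpose_mat W * A * W"
  proof -
    have "transpose_mat (transpose_mat W * A * W) = transpose_mat W * transpose_mat (transpose_mat W * A)"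
      using A W by (intro transpose_mult[of _ m n]) auto
    also have "transpose_mat (transpose_mat W * A) = A * W"
      using A W by (simp add: transpose_mult[of _ m n] spd_symmetric)
    also have "transpose_mat W * (A * W) = transpose_mat W * A * W"
      using A W by (intro assoc_mult_mat[symmetric, of _ m n _ n _ m]) auto
    finally show ?thesis .
  qed
  fix v :: "real vec" assume v: "v \<in> carrier_vec m" "v \<noteq> 0\<^sub>v m"
  have "v \<bullet> (transpose_mat W * A * W *\<^sub>v v) = v \<bullet> (transpose_mat W *\<^sub>v (A *\<^sub>v (W *\<^sub>v v)))"
    using A W v by (simp add: assoc_mult_mat_vec[of _ m n _ m] assoc_mult_mat_vec[of _ m n _ n])
  also have "\<dots> = (transpose_mat W *\<^sub>v (A *\<^sub>v (W *\<^sub>v v))) \<bullet> v"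
    using A W v by (intro comm_scalar_prod[of _ m]) auto
  also have "\<dots> = (A *\<^sub>v (W *\<^sub>v v)) \<bullet> (W *\<^sub>v v)"
    using A W v by (intro transpose_vec_mult_scalar) auto
  also have "\<dots> = (W *\<^sub>v v) \<bullet> (A *\<^sub>v (W *\<^sub>v v))"
    using A W v by (intro comm_scalar_prod[of _ n]) auto
  also have "\<dots> > 0"
    using A W v inj[of v] by (intro spd_pos[of _ n]) auto
  finally show "v \<bullet> (transpose_mat W * A * W *\<^sub>v v) > 0" .
qed

text \<open>\<open>matinv\<close> is \<open>the\<close> of an option, so the point is that
  \<open>mat_inverse\<close> returns \<open>Some\<close>: a trivial kernel makes the determinant
  nonzero, hence A a unit of the matrix ring.\<close>

lemma inverse_if_injective:
  fixes A :: "real mat"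
  assumes A: "A \<in> carrier_mat n n"
    and inj: "\<And>v. v \<in> carrier_vec n \<Longrightarrow> A *\<^sub>v v = 0\<^sub>v n \<Longrightarrow> v = 0\<^sub>v n"
  shows "matinv A \<in> carrier_mat n n" "A * matinv A = 1\<^sub>m n" "matinv A * A = 1\<^sub>m n"
proof -
  have "det A \<noteq> 0" using inj by (subst det_0_iff_vec_prod_zero_field[OF A]) blast
  hence "A \<in> Units (ring_mat TYPE(real) n ())" by (rule det_non_zero_imp_unit[OF A])
  then obtain B where "mat_inverse A = Some B"
    using mat_inverse(1)[OF A, of "()"] by (cases "mat_inverse A") auto
  with mat_inverse(2)[OF A this]
  show "matinv A \<in> carrier_mat n n" "A * matinv A = 1\<^sub>m n" "matinv A * A = 1\<^sub>m n" by auto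
qed

lemma spd_injective:
  assumes "A \<in> carrier_mat n n" "spd A" "v \<in> carrier_vec n" "A *\<^sub>v v = 0\<^sub>v n"
  shows "v = 0\<^sub>v n"
  using spd_pos[OF assms(2,1,3)] assms by auto

lemma spd_inverse:
  assumes "A \<in> carrier_mat n n" "spd A"
  shows "matinv A \<in> carrier_mat n n" "A * matinv A = 1\<^sub>m n" "matinv A * A = 1\<^sub>m n"
  using inverse_if_injective[OF assms(1) spd_injective[OF assms]] by auto

lemma spd_inverse_mult_vec:
  assumes A: "A \<in> carrier_mat n n" "spd A" and v: "v \<in> carrier_vec n"
  shows "A *\<^sub>v (matinv A *\<^sub>v v) = v" "matinv A *\<^sub>v (A *\<^sub>v v) = v"
  using spd_inverse[OF A] A v
  by (simp_all flip: assoc_mult_mat_vec[of _ n n _ n])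

section \<open>Real eigenvectors, reflections and the construction of the root\<close>

text \<open>The characteristic polynomial has a complex root z with eigenvector w = x + i y.
  Comparing \<open>(A *\<^sub>v x) \<bullet> y\<close> with
  \<open>x \<bullet> (A *\<^sub>v y)\<close> gives Im z (|x|^2 + |y|^2) = 0, so z is real, and x and
  y both satisfy the real eigenvector equation; at least one of them is nonzero.\<close>

lemma symmetric_real_eigenvector:
  fixes A :: "real mat"
  assumes A: "A \<in> carrier_mat n n" and sym: "transpose_mat A = A" and n: "n > 0"
  obtains e v where "v \<in> carrier_vec n" "v \<noteq> 0\<^sub>v n" "A *\<^sub>v v = e \<cdot>\<^sub>v v"
proof -
  define C where "C = map_mat complex_of_real A"
  have C: "C \<in> carrier_mat n n" using A by (simp add: C_def)
  have "degree (char_poly C) = n" using degree_monic_char_poly[OF C] by simp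
  hence "\<not> constant (poly (char_poly C))" using n by (simp add: constant_degree)
  then obtain z where "poly (char_poly C) z = 0" using fundamental_theorem_of_algebra by blast
  hence "eigenvalue C z" by (simp add: eigenvalue_root_char_poly[OF C])
  then obtain w where w: "w \<in> carrier_vec n" "w \<noteq> 0\<^sub>v n" "C *\<^sub>v w = z \<cdot>\<^sub>v w"
    using C unfolding eigenvalue_def eigenvector_def by auto
  define x y where "x = map_vec Re w" and "y = map_vec Im w"
  have xy: "x \<in> carrier_vec n" "y \<in> carrier_vec n" using w by (auto simp: x_def y_def)
  have Cw: "(C *\<^sub>v w) $ i = (\<Sum>k<n. complex_of_real (A $$ (i, k)) * w $ k)" if "i < n" for i
  proof -
    have "(C *\<^sub>v w) $ i = (\<Sum>k = 0..<n. C $$ (i, k) * w $ k)"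
      using that C w(1) by (simp add: scalar_prod_def)
    thus ?thesis using that A by (simp add: C_def lessThan_atLeast0)
  qed
  have Ax: "A *\<^sub>v x = Re z \<cdot>\<^sub>v x - Im z \<cdot>\<^sub>v y"
  proof (rule eq_vecI)
    fix i assume "i < dim_vec (Re z \<cdot>\<^sub>v x - Im z \<cdot>\<^sub>v y)"
    hence i: "i < n" using xy by simp
    have "(A *\<^sub>v x) $ i = Re ((C *\<^sub>v w) $ i)"
      using i A w(1) unfolding Cw[OF i] by (simp add: x_def scalar_prod_def lessThan_atLeast0)
    also have "\<dots> = (Re z \<cdot>\<^sub>v x - Im z \<cdot>\<^sub>v y) $ i"
      using i w by (simp add: x_def y_def)
    finally show "(A *\<^sub>v x) $ i = (Re z \<cdot>\<^sub>v x - Im z \<cdot>\<^sub>v y) $ i" .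
  qed (use A xy in auto)
  have Ay: "A *\<^sub>v y = Re z \<cdot>\<^sub>v y + Im z \<cdot>\<^sub>v x"
  proof (rule eq_vecI)
    fix i assume "i < dim_vec (Re z \<cdot>\<^sub>v y + Im z \<cdot>\<^sub>v x)"
    hence i: "i < n" using xy by simp
    have "(A *\<^sub>v y) $ i = Im ((C *\<^sub>v w) $ i)"
      using i A w(1) unfolding Cw[OF i] by (simp add: y_def scalar_prod_def lessThan_atLeast0)
    also have "\<dots> = (Re z \<cdot>\<^sub>v y + Im z \<cdot>\<^sub>v x) $ i"
      using i w by (simp add: x_def y_def)
    finally show "(A *\<^sub>v y) $ i = (Re z \<cdot>\<^sub>v y + Im z \<cdot>\<^sub>v x) $ i" .
  qed (use A xy in auto)
  have "(A *\<^sub>v x) \<bullet> y = x \<bullet> (A *\<^sub>v y)" by (rule symmetric_scalar_prod[OF A sym xy(2,1)])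
  also have "(A *\<^sub>v x) \<bullet> y = Re z * (x \<bullet> y) - Im z * (y \<bullet> y)"
    unfolding Ax using xy by (simp add: minus_scalar_prod_distrib[of _ n])
  also have "x \<bullet> (A *\<^sub>v y) = Re z * (x \<bullet> y) + Im z * (x \<bullet> x)"
    unfolding Ay using xy by (simp add: scalar_prod_add_distrib[of _ n])
  finally have "Im z * (x \<bullet> x + y \<bullet> y) = 0" by (simp add: distrib_left)
  moreover have nz: "x \<noteq> 0\<^sub>v n \<or> y \<noteq> 0\<^sub>v n"
  proof (rule ccontr)
    assume "\<not> (x \<noteq> 0\<^sub>v n \<or> y \<noteq> 0\<^sub>v n)"
    hence "x = 0\<^sub>v n" "y = 0\<^sub>v n" by auto
    have "w $ i = 0" if i: "i < n" for i
    proof -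
      have "Re (w $ i) = x $ i" "Im (w $ i) = y $ i" using i w(1) by (simp_all add: x_def y_def)
      thus ?thesis using i \<open>x = 0\<^sub>v n\<close> \<open>y = 0\<^sub>v n\<close> by (simp add: complex_eq_iff)
    qed
    hence "w = 0\<^sub>v n" using w(1) by (intro eq_vecI) auto
    thus False using w(2) by contradiction
  qed
  hence "x \<bullet> x + y \<bullet> y \<noteq> 0"
    using scalar_prod_self_nonneg[of x] scalar_prod_self_nonneg[of y]
      scalar_prod_self_eq_0_iff[OF xy(1)] scalar_prod_self_eq_0_iff[OF xy(2)] by linarith
  ultimately have "Im z = 0" by simp
  hence "A *\<^sub>v x = Re z \<cdot>\<^sub>v x" "A *\<^sub>v y = Re z \<cdot>\<^sub>v y"
    unfolding Ax Ay using xy by (auto intro!: eq_vecI)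
  thus thesis using nz xy that by blast
qed

text \<open>W is I - 2 u u^T / (u . u) with u = v - e_0, the reflection in the hyperplane orthogonal
  to u. It exchanges v and e_0 because both are unit vectors. If v = e_0, then u vanishes and the
  identity is taken instead.\<close>

lemma householder_reflection:
  fixes v :: "real vec"
  assumes v: "v \<in> carrier_vec n" "v \<bullet> v = 1" and n: "n > 0"
  obtains W where "W \<in> carrier_mat n n" "transpose_mat W = W" "W * W = 1\<^sub>m n"
    "W *\<^sub>v v = unit_vec n 0"
proof (cases "v = unit_vec n 0")
  case True
  thus thesis using that[of "1\<^sub>m n"] by simp
next
  case False
  define u where "u = v - unit_vec n 0"
  have u: "u \<in> carrier_vec n" using v by (simp add: u_def)
  have "u \<noteq> 0\<^sub>v n"
  proof
    assume "u = 0\<^sub>v n"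
    have "v $ i = unit_vec n 0 $ i" if i: "i < n" for i
    proof -
      have "v $ i - unit_vec n 0 $ i = u $ i" using i v by (simp add: u_def)
      also have "u $ i = 0" using i \<open>u = 0\<^sub>v n\<close> by simp
      finally show ?thesis by simp
    qed
    hence "v = unit_vec n 0" using v(1) by (intro eq_vecI) (simp_all del: index_unit_vec(1))
    thus False using False by contradiction
  qed
  hence uu: "u \<bullet> u \<noteq> 0" using scalar_prod_self_eq_0_iff[OF u] by simp
  define c where "c = 2 / (u \<bullet> u)"
  define W where "W = mat n n (\<lambda>(i, j). (if i = j then 1 else 0) - c * u $ i * u $ j)"
  have W: "W \<in> carrier_mat n n" by (simp add: W_def)
  have Wx: "W *\<^sub>v x = x - (c * (u \<bullet> x)) \<cdot>\<^sub>v u" if x: "x \<in> carrier_vec n" for x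
  proof (rule eq_vecI)
    fix i assume "i < dim_vec (x - (c * (u \<bullet> x)) \<cdot>\<^sub>v u)"
    hence i: "i < n" using u by simp
    have "(W *\<^sub>v x) $ i = (\<Sum>k = 0..<n. ((if i = k then 1 else 0) - c * u $ i * u $ k) * x $ k)"
      using i x by (auto simp: W_def scalar_prod_def intro!: sum.cong)
    also have "\<dots> = (\<Sum>k = 0..<n. (if i = k then x $ k else 0) - (c * u $ i) * (u $ k * x $ k))"
      by (intro sum.cong) (auto simp: algebra_simps)
    also have "\<dots> = x $ i - (c * u $ i) * (\<Sum>k = 0..<n. u $ k * x $ k)"
      using i by (simp add: sum_subtractf sum_distrib_left)
    also have "(\<Sum>k = 0..<n. u $ k * x $ k) = u \<bullet> x" using x by (simp add: scalar_prod_def)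
    finally show "(W *\<^sub>v x) $ i = (x - (c * (u \<bullet> x)) \<cdot>\<^sub>v u) $ i" using i u x by simp
  qed (use W u in auto)
  have "W *\<^sub>v (W *\<^sub>v x) = x" if x: "x \<in> carrier_vec n" for x
  proof -
    \<comment> \<open>The reflection reverses the component along u; this is where c = 2 / (u . u)
      is needed, and it makes W an involution.\<close>
    have "u \<bullet> (W *\<^sub>v x) = - (u \<bullet> x)"
      using u x uu unfolding Wx[OF x] by (simp add: scalar_prod_minus_distrib[of _ n] c_def)
    hence "W *\<^sub>v (W *\<^sub>v x) = (x - (c * (u \<bullet> x)) \<cdot>\<^sub>v u) - (c * - (u \<bullet> x)) \<cdot>\<^sub>v u"
      using Wx[OF mult_mat_vec_carrier[OF W x]] unfolding Wx[OF x] by simp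
    also have "\<dots> = x" using u x by (intro eq_vecI) auto
    finally show ?thesis .
  qed
  hence WW: "W * W = 1\<^sub>m n"
    using W by (intro mat_eq_by_mult_vec[of _ n n]) auto
  have v0: "unit_vec n 0 \<bullet> v = v $ 0" "v \<bullet> unit_vec n 0 = v $ 0"
    using v n by (auto simp: scalar_prod_left_unit scalar_prod_right_unit)
  have "u \<bullet> v = 1 - v $ 0"
    using v v0 by (simp add: u_def minus_scalar_prod_distrib[of _ n])
  moreover have "u \<bullet> u = 2 - 2 * v $ 0"
    using v v0 n by (simp add: u_def minus_scalar_prod_distrib[of _ n] scalar_prod_minus_distrib[of _ n])
  \<comment> \<open>The two values above give u . u = 2 (u . v), so W subtracts exactly one copy of
    u from v and leaves e_0.\<close>
  ultimately have "c * (u \<bullet> v) = 1" using uu by (simp add: c_def field_simps)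
  hence "W *\<^sub>v v = unit_vec n 0"
    unfolding Wx[OF v(1)] using v by (intro eq_vecI) (auto simp: u_def)
  moreover have "transpose_mat W = W" by (rule eq_matI) (auto simp: W_def)
  ultimately show thesis using W WW that by blast
qed

text \<open>The quadratic form of the block matrix is the sum of the forms of its blocks, and
  padding a vector with zeros isolates one block. The square root needs both directions: one to make
  the deflated block positive definite, the other to assemble the root.\<close>

lemma spd_four_block_diag:
  assumes A: "A \<in> carrier_mat n n" and D: "D \<in> carrier_mat m m"
  shows "spd (four_block_mat A (0\<^sub>m n m) (0\<^sub>m m n) D) \<longleftrightarrow> spd A \<and> spd D" (is "spd ?B \<longleftrightarrow> _")
proof -
  have B: "?B \<in> carrier_mat (n + m) (n + m)" using A D by simp
  have form: "(a @\<^sub>v d) \<bullet> (?B *\<^sub>v (a @\<^sub>v d)) = a \<bullet> (A *\<^sub>v a) + d \<bullet> (D *\<^sub>v d)"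
    if "a \<in> carrier_vec n" "d \<in> carrier_vec m" for a d
    using A D that by (simp add: mult_mat_vec_split[OF A D] scalar_prod_append[of _ n _ m])
  have split: "v = vec_first v n @\<^sub>v vec_last v m" if "v \<in> carrier_vec (n + m)" for v :: "real vec"
    using that by simp
  have zero: "a @\<^sub>v d = 0\<^sub>v (n + m) \<longleftrightarrow> a = 0\<^sub>v n \<and> d = 0\<^sub>v m"
    if "a \<in> carrier_vec n" "d \<in> carrier_vec m" for a d :: "real vec"
  proof -
    have "0\<^sub>v (n + m) = 0\<^sub>v n @\<^sub>v (0\<^sub>v m :: real vec)" by auto
    thus ?thesis using that by simp
  qed
  have tr: "transpose_mat ?B = four_block_mat (transpose_mat A) (0\<^sub>m n m) (0\<^sub>m m n) (transpose_mat D)"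
    using A D by (simp add: transpose_four_block_mat[of _ n n _ m _ m])
  show ?thesis
  proof
    assume B': "spd ?B"
    show "spd A \<and> spd D"
    proof (intro conjI spdI[OF A] spdI[OF D])
      show "transpose_mat A = A"
      proof (rule eq_matI)
        fix i j assume "i < dim_row A" "j < dim_col A"
        thus "transpose_mat A $$ (i, j) = A $$ (i, j)"
          using A D arg_cong[OF spd_symmetric[OF B'], of "\<lambda>M. M $$ (i, j)"] by simp
      qed (use A in auto)
      show "transpose_mat D = D"
      proof (rule eq_matI)
        fix i j assume "i < dim_row D" "j < dim_col D"
        thus "transpose_mat D $$ (i, j) = D $$ (i, j)"
          using A D arg_cong[OF spd_symmetric[OF B'], of "\<lambda>M. M $$ (n + i, n + j)"] by simp
      qed (use D in auto)
      show "v \<bullet> (A *\<^sub>v v) > 0" if v: "v \<in> carrier_vec n" "v \<noteq> 0\<^sub>v n" for v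
        using spd_pos[OF B' B, of "v @\<^sub>v 0\<^sub>v m"] form[OF v(1), of "0\<^sub>v m"] v zero[OF v(1), of "0\<^sub>v m"] D
        by (auto simp del: append_vec_eq)
      show "v \<bullet> (D *\<^sub>v v) > 0" if v: "v \<in> carrier_vec m" "v \<noteq> 0\<^sub>v m" for v
        using spd_pos[OF B' B, of "0\<^sub>v n @\<^sub>v v"] form[OF _ v(1), of "0\<^sub>v n"] v zero[OF _ v(1), of "0\<^sub>v n"] A
        by auto
    qed
  next
    assume AD: "spd A \<and> spd D"
    show "spd ?B"
    proof (rule spdI[OF B])
      show "transpose_mat ?B = ?B" using AD by (simp add: tr spd_symmetric)
      fix v :: "real vec" assume v: "v \<in> carrier_vec (n + m)" "v \<noteq> 0\<^sub>v (n + m)"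
      define a d where "a = vec_first v n" and "d = vec_last v m"
      have ad: "a \<in> carrier_vec n" "d \<in> carrier_vec m" "v = a @\<^sub>v d"
        using v split by (auto simp: a_def d_def)
      hence "a \<noteq> 0\<^sub>v n \<or> d \<noteq> 0\<^sub>v m" using v zero by blast
      moreover have "a \<bullet> (A *\<^sub>v a) > 0 \<or> a = 0\<^sub>v n" "d \<bullet> (D *\<^sub>v d) > 0 \<or> d = 0\<^sub>v m"
        using AD A D ad by (auto intro: spd_pos)
      ultimately show "v \<bullet> (?B *\<^sub>v v) > 0"
        using form[OF ad(1,2)] ad(3) A D by auto
    qed
  qed
qed

lemma spd_1x1_iff: "spd (mat 1 1 (\<lambda>_. r)) \<longleftrightarrow> r > 0"
proof
  assume "spd (mat 1 1 (\<lambda>_. r))"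
  from spd_pos[OF this, of 1 "unit_vec 1 0"] show "r > 0"
    by (simp add: scalar_prod_def)
next
  assume r: "r > 0"
  show "spd (mat 1 1 (\<lambda>_. r))"
  proof (rule spdI[of _ 1])
    fix v :: "real vec" assume v: "v \<in> carrier_vec 1" "v \<noteq> 0\<^sub>v 1"
    hence "v \<bullet> v > 0"
      using scalar_prod_self_nonneg[of v] scalar_prod_self_eq_0_iff[of v 1] by linarith
    moreover have "v \<bullet> (mat 1 1 (\<lambda>_. r) *\<^sub>v v) = r * (v \<bullet> v)"
      using v(1) by (simp add: scalar_prod_def)
    ultimately show "v \<bullet> (mat 1 1 (\<lambda>_. r) *\<^sub>v v) > 0"
      using r by simp
  next
    show "transpose_mat (mat 1 1 (\<lambda>_. r)) = mat 1 1 (\<lambda>_. r)" by (rule eq_matI) auto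
  qed simp
qed

lemma involution_mult_vec:
  fixes W :: "real mat"
  assumes "W \<in> carrier_mat n n" "W * W = 1\<^sub>m n" "x \<in> carrier_vec n"
  shows "W *\<^sub>v (W *\<^sub>v x) = x"
  using assoc_mult_mat_vec[OF assms(1,1,3)] assms(2,3) by simp

lemma involution_injective:
  fixes W :: "real mat"
  assumes W: "W \<in> carrier_mat n n" "W * W = 1\<^sub>m n" and x: "x \<in> carrier_vec n" "W *\<^sub>v x = 0\<^sub>v n"
  shows "x = 0\<^sub>v n"
proof -
  have "x = W *\<^sub>v 0\<^sub>v n" using involution_mult_vec[OF W x(1)] x(2) by simp
  also have "\<dots> = 0\<^sub>v n" using W(1) by auto
  finally show ?thesis .
qed

lemma sandwich_mult_vec:
  fixes A W :: "real mat"
  assumes "A \<in> carrier_mat n n" "W \<in> carrier_mat n n" "x \<in> carrier_vec n"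
  shows "(W * A * W) *\<^sub>v x = W *\<^sub>v (A *\<^sub>v (W *\<^sub>v x))"
proof -
  have "(W * A * W) *\<^sub>v x = (W * A) *\<^sub>v (W *\<^sub>v x)"
    using assms by (intro assoc_mult_mat_vec[of _ n n]) auto
  also have "\<dots> = W *\<^sub>v (A *\<^sub>v (W *\<^sub>v x))"
    using assms by (intro assoc_mult_mat_vec[of _ n n]) auto
  finally show ?thesis .
qed

text \<open>Since W is its own inverse and sends the unit eigenvector to e_0, the vector e_0 is an
  eigenvector of W A W. This fixes the first column, and symmetry copies it to the first
  row.\<close>

lemma symmetric_deflation:
  fixes A :: "real mat"
  assumes A: "A \<in> carrier_mat (Suc n) (Suc n)" and sym: "transpose_mat A = A"
  obtains W e D where "W \<in> carrier_mat (Suc n) (Suc n)" "transpose_mat W = W"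
    "W * W = 1\<^sub>m (Suc n)" "D \<in> carrier_mat n n"
    "W * A * W = four_block_mat (mat 1 1 (\<lambda>_. e)) (0\<^sub>m 1 n) (0\<^sub>m n 1) D"
proof -
  obtain e v' where v': "v' \<in> carrier_vec (Suc n)" "v' \<noteq> 0\<^sub>v (Suc n)" "A *\<^sub>v v' = e \<cdot>\<^sub>v v'"
    using symmetric_real_eigenvector[OF A sym] by blast
  have pos: "v' \<bullet> v' > 0"
    using scalar_prod_self_nonneg[of v'] scalar_prod_self_eq_0_iff[OF v'(1)] v'(2) by linarith
  define v where "v = (1 / sqrt (v' \<bullet> v')) \<cdot>\<^sub>v v'"
  have v: "v \<in> carrier_vec (Suc n)" using v' by (simp add: v_def)
  have vv: "v \<bullet> v = 1" using v'(1) pos by (simp add: v_def)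
  have Av: "A *\<^sub>v v = e \<cdot>\<^sub>v v"
    unfolding v_def mult_mat_vec[OF A v'(1)] v'(3) by (simp add: smult_smult_assoc mult.commute)
  obtain W where W: "W \<in> carrier_mat (Suc n) (Suc n)" "transpose_mat W = W" "W * W = 1\<^sub>m (Suc n)"
      "W *\<^sub>v v = unit_vec (Suc n) 0"
    using householder_reflection[OF v vv] by blast
  note WWx = involution_mult_vec[OF W(1,3)]
  define A' where "A' = W * A * W"
  have A': "A' \<in> carrier_mat (Suc n) (Suc n)" using A W(1) by (simp add: A'_def)
  have symA': "transpose_mat A' = A'"
  proof -
    have "transpose_mat A' = transpose_mat W * transpose_mat (W * A)"
      unfolding A'_def using A W(1) by (intro transpose_mult[of _ "Suc n" "Suc n"]) auto
    also have "transpose_mat (W * A) = A * W"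
      using transpose_mult[OF W(1) A] W(2) sym by simp
    also have "transpose_mat W * (A * W) = A'"
      unfolding W(2) A'_def by (rule assoc_mult_mat[OF W(1) A W(1), symmetric])
    finally show ?thesis .
  qed
  have "A' *\<^sub>v unit_vec (Suc n) 0 = W *\<^sub>v (A *\<^sub>v (W *\<^sub>v unit_vec (Suc n) 0))"
    unfolding A'_def by (rule sandwich_mult_vec[OF A W(1)]) simp
  also have "\<dots> = e \<cdot>\<^sub>v unit_vec (Suc n) 0"
    by (simp only: WWx[OF v] Av mult_mat_vec[OF W(1) v] W(4)[symmetric])
  finally have A'_unit: "A' *\<^sub>v unit_vec (Suc n) 0 = e \<cdot>\<^sub>v unit_vec (Suc n) 0" .
  have col0: "A' $$ (i, 0) = (if i = 0 then e else 0)" if i: "i < Suc n" for i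
  proof -
    have "A' $$ (i, 0) = (A' *\<^sub>v unit_vec (Suc n) 0) $ i"
      by (rule mult_unit_vec_index[OF A' i, symmetric]) simp
    thus ?thesis unfolding A'_unit using i by simp
  qed
  have row0: "A' $$ (0, i) = (if i = 0 then e else 0)" if i: "i < Suc n" for i
  proof -
    have "A' $$ (0, i) = transpose_mat A' $$ (i, 0)" using i A' by simp
    thus ?thesis unfolding symA' col0[OF i] .
  qed
  define D where "D = mat n n (\<lambda>(i, j). A' $$ (Suc i, Suc j))"
  have D: "D \<in> carrier_mat n n" by (simp add: D_def)
  have "A' = four_block_mat (mat 1 1 (\<lambda>_. e)) (0\<^sub>m 1 n) (0\<^sub>m n 1) D"
  proof (rule eq_matI)
    fix i j
    assume "i < dim_row (four_block_mat (mat 1 1 (\<lambda>_. e)) (0\<^sub>m 1 n) (0\<^sub>m n 1) D)"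
      and "j < dim_col (four_block_mat (mat 1 1 (\<lambda>_. e)) (0\<^sub>m 1 n) (0\<^sub>m n 1) D)"
    thus "A' $$ (i, j) = four_block_mat (mat 1 1 (\<lambda>_. e)) (0\<^sub>m 1 n) (0\<^sub>m n 1) D $$ (i, j)"
      using col0[of i] row0[of j] D by (cases i; cases j) (auto simp: D_def)
  qed (use A' D in auto)
  thus thesis using that W D unfolding A'_def by blast
qed

lemma spd_sqrt_exists:
  assumes "A \<in> carrier_mat n n" "spd A"
  shows "\<exists>B. spd B \<and> B \<in> carrier_mat n n \<and> B * B = A"
  using assms
proof (induction n arbitrary: A)
  case 0
  \<comment> \<open>There is only one 0 x 0 matrix, so A is its own square root.\<close>
  thus ?case by (intro exI[of _ A]) auto
next
  case (Suc n)
  note A = Suc.prems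
  obtain W e D where W: "W \<in> carrier_mat (Suc n) (Suc n)" "transpose_mat W = W"
      "W * W = 1\<^sub>m (Suc n)" and D: "D \<in> carrier_mat n n"
      and blk: "W * A * W = four_block_mat (mat 1 1 (\<lambda>_. e)) (0\<^sub>m 1 n) (0\<^sub>m n 1) D"
    using symmetric_deflation[OF A(1) spd_symmetric[OF A(2)]] by blast
  note WWx = involution_mult_vec[OF W(1,3)] and W_inj = involution_injective[OF W(1,3)]
  have "spd (W * A * W)"
    using spd_congruence[OF A W(1) W_inj] unfolding W(2) .
  hence e: "e > 0" and spdD: "spd D"
    unfolding blk by (simp_all only: spd_four_block_diag[OF mat_carrier D] spd_1x1_iff)
  obtain R where R: "spd R" "R \<in> carrier_mat n n" "R * R = D"
    using Suc.IH[OF D spdD] by blast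
  define B' where "B' = four_block_mat (mat 1 1 (\<lambda>_. sqrt e)) (0\<^sub>m 1 n) (0\<^sub>m n 1) R"
  have B': "B' \<in> carrier_mat (Suc n) (Suc n)" 
    using four_block_carrier_mat[of "mat 1 1 (\<lambda>_. sqrt e)" 1 1 R n n "0\<^sub>m 1 n" "0\<^sub>m n 1"] R(2)
    by (simp add: B'_def)
  have spdB': "spd B'"
    unfolding B'_def spd_four_block_diag[OF mat_carrier R(2)] spd_1x1_iff using R(1) e by simp
  have sq: "mat 1 1 (\<lambda>_. sqrt e) * mat 1 1 (\<lambda>_. sqrt e) = mat 1 1 (\<lambda>_. e)"
    using e by (intro eq_matI) (auto simp: scalar_prod_def)
  have B'B': "B' * B' = W * A * W"
    unfolding B'_def blk using R(2,3) sq
    by (subst mult_four_block_mat[of _ 1 1 _ n _ n _ _ 1 _ n]) auto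
  \<comment> \<open>The root of the block matrix is conjugated back by the same reflection. In B B
    the two inner factors W cancel, which leaves W (W A W) W = A; the computation is done on
    vectors.\<close>
  define B where "B = W * B' * W"
  have B: "B \<in> carrier_mat (Suc n) (Suc n)" using B' W(1) by (simp add: B_def)
  have "spd B"
    using spd_congruence[OF B' spdB' W(1) W_inj] unfolding B_def W(2) .
  moreover have "B * B = A"
  proof (rule mat_eq_by_mult_vec)
    fix x :: "real vec" assume x: "x \<in> carrier_vec (Suc n)"
    define y where "y = B' *\<^sub>v (W *\<^sub>v x)"
    have y: "y \<in> carrier_vec (Suc n)" using B' W(1) x by (simp add: y_def)
    have Wx: "W *\<^sub>v x \<in> carrier_vec (Suc n)" using W(1) x by simp
    have "B * B *\<^sub>v x = B *\<^sub>v (B *\<^sub>v x)" by (rule assoc_mult_mat_vec[OF B B x])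
    also have "B *\<^sub>v x = W *\<^sub>v y"
      unfolding B_def y_def by (rule sandwich_mult_vec[OF B' W(1) x])
    also have "B *\<^sub>v (W *\<^sub>v y) = W *\<^sub>v (B' *\<^sub>v (W *\<^sub>v (W *\<^sub>v y)))"
      unfolding B_def using W(1) y by (intro sandwich_mult_vec[OF B' W(1)]) simp
    also have "\<dots> = W *\<^sub>v (B' *\<^sub>v y)" unfolding WWx[OF y] ..
    also have "B' *\<^sub>v y = (W * A * W) *\<^sub>v (W *\<^sub>v x)"
      unfolding y_def B'B'[symmetric] by (rule assoc_mult_mat_vec[OF B' B' Wx, symmetric])
    also have "\<dots> = W *\<^sub>v (A *\<^sub>v x)"
      unfolding sandwich_mult_vec[OF A(1) W(1) Wx] WWx[OF x] ..
    also have "W *\<^sub>v \<dots> = A *\<^sub>v x" using A(1) x by (intro WWx) simp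
    finally show "B * B *\<^sub>v x = A *\<^sub>v x" .
  qed (use A(1) B in auto)
  ultimately show ?case using B by blast
qed

section \<open>Energy norms\<close>

text \<open>The link to \<open>L2_set\<close>, from which the triangle and Cauchy-Schwarz
  inequalities are taken.\<close>

lemma eucl_norm_eq_L2_set: "eucl_norm v = L2_set (($) v) {..<dim_vec v}"
  by (simp add: eucl_norm_def L2_set_def scalar_prod_def power2_eq_square lessThan_atLeast0)

lemma eucl_norm_nonneg: "eucl_norm v \<ge> 0"
  by (simp add: eucl_norm_def scalar_prod_self_nonneg)

lemma eucl_norm_0 [simp]: "eucl_norm (0\<^sub>v n) = 0"
  by (simp add: eucl_norm_def)

lemma eucl_norm_triangle:
  assumes "v \<in> carrier_vec n" "w \<in> carrier_vec n"
  shows "eucl_norm (v + w) \<le> eucl_norm v + eucl_norm w"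
proof -
  have "eucl_norm (v + w) = L2_set (\<lambda>i. v $ i + w $ i) {..<n}"
    unfolding eucl_norm_eq_L2_set using assms by (intro L2_set_cong) auto
  also have "\<dots> \<le> L2_set (($) v) {..<n} + L2_set (($) w) {..<n}"
    by (rule L2_set_triangle_ineq)
  finally show ?thesis using assms by (simp add: eucl_norm_eq_L2_set)
qed

lemma abs_scalar_prod_le:
  assumes "v \<in> carrier_vec n" "w \<in> carrier_vec n"
  shows "\<bar>v \<bullet> w\<bar> \<le> eucl_norm v * eucl_norm w"
proof -
  have "\<bar>v \<bullet> w\<bar> \<le> (\<Sum>i<n. \<bar>v $ i\<bar> * \<bar>w $ i\<bar>)"
    using assms by (simp add: scalar_prod_def lessThan_atLeast0 flip: abs_mult)
  also have "\<dots> \<le> L2_set (($) v) {..<n} * L2_set (($) w) {..<n}"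
    by (rule L2_set_mult_ineq)
  finally show ?thesis using assms by (simp add: eucl_norm_eq_L2_set)
qed

text \<open>A crude constant, the sum of the Euclidean norms of the rows: the 2-norm is at most the
  1-norm, and each entry of A v is bounded by Cauchy-Schwarz. Only its finiteness matters
  later.\<close>

lemma eucl_norm_mult_mat_vec_bound:
  assumes A: "A \<in> carrier_mat m n"
  obtains K where "K \<ge> 0" "\<And>v. v \<in> carrier_vec n \<Longrightarrow> eucl_norm (A *\<^sub>v v) \<le> K * eucl_norm v"
proof
  show "(\<Sum>i<m. eucl_norm (row A i)) \<ge> 0" by (intro sum_nonneg eucl_norm_nonneg)
  fix v :: "real vec" assume v: "v \<in> carrier_vec n"
  have "eucl_norm (A *\<^sub>v v) \<le> (\<Sum>i<m. \<bar>(A *\<^sub>v v) $ i\<bar>)"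
    unfolding eucl_norm_eq_L2_set dim_mult_mat_vec carrier_matD(1)[OF A] by (rule L2_set_le_sum_abs)
  also have "\<dots> \<le> (\<Sum>i<m. eucl_norm (row A i) * eucl_norm v)"
    using A v by (intro sum_mono) (auto intro!: abs_scalar_prod_le[of _ n])
  finally show "eucl_norm (A *\<^sub>v v) \<le> (\<Sum>i<m. eucl_norm (row A i)) * eucl_norm v"
    by (simp add: sum_distrib_right)
qed

lemma mult_mat_vec_0: "A \<in> carrier_mat m n \<Longrightarrow> A *\<^sub>v 0\<^sub>v n = (0\<^sub>v m :: real vec)"
  by auto

lemma spd_sqrt:
  assumes "A \<in> carrier_mat n n" "spd A"
  shows "spd (spd_sqrt A)" "spd_sqrt A \<in> carrier_mat n n" "spd_sqrt A * spd_sqrt A = A"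
proof -
  have dim: "dim_row A = n" using assms(1) by simp
  have "spd (spd_sqrt A) \<and> spd_sqrt A \<in> carrier_mat n n \<and> spd_sqrt A * spd_sqrt A = A"
    unfolding spd_sqrt_def dim by (rule someI_ex[OF spd_sqrt_exists[OF assms]])
  thus "spd (spd_sqrt A)" "spd_sqrt A \<in> carrier_mat n n" "spd_sqrt A * spd_sqrt A = A"
    by blast+
qed

lemma energy_norm_nonneg: "energy_norm A v \<ge> 0"
  by (simp add: energy_norm_def eucl_norm_nonneg)

lemma energy_norm_0:
  assumes "A \<in> carrier_mat n n" "spd A"
  shows "energy_norm A (0\<^sub>v n) = 0"
  using mult_mat_vec_0[OF spd_sqrt(2)[OF assms]] by (simp add: energy_norm_def)

lemma energy_norm_triangle:
  assumes "A \<in> carrier_mat n n" "spd A" "v \<in> carrier_vec n" "w \<in> carrier_vec n"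
  shows "energy_norm A (v + w) \<le> energy_norm A v + energy_norm A w"
  unfolding energy_norm_def mult_add_distrib_mat_vec[OF spd_sqrt(2)[OF assms(1,2)] assms(3,4)]
  
  using spd_sqrt(2)[OF assms(1,2)] assms(3,4) by (intro eucl_norm_triangle[of _ n]) auto

text \<open>Moving one symmetric root across the scalar product merges the two roots into A. This
  form makes positive definiteness and the Galerkin condition directly applicable.\<close>

lemma energy_norm_eq:
  assumes A: "A \<in> carrier_mat n n" "spd A" and v: "v \<in> carrier_vec n"
  shows "energy_norm A v = sqrt (v \<bullet> (A *\<^sub>v v))"
proof -
  note R = spd_sqrt[OF A]
  have "(spd_sqrt A *\<^sub>v v) \<bullet> (spd_sqrt A *\<^sub>v v) = v \<bullet> (spd_sqrt A *\<^sub>v (spd_sqrt A *\<^sub>v v))"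
    using R(2) v by (intro symmetric_scalar_prod[OF R(2) spd_symmetric[OF R(1)]]) auto
  also have "spd_sqrt A *\<^sub>v (spd_sqrt A *\<^sub>v v) = A *\<^sub>v v"
    using assoc_mult_mat_vec[OF R(2) R(2) v] R(3) by simp
  finally show ?thesis by (simp add: energy_norm_def eucl_norm_def)
qed

lemma energy_norm_pos:
  assumes "A \<in> carrier_mat n n" "spd A" "v \<in> carrier_vec n" "v \<noteq> 0\<^sub>v n"
  shows "energy_norm A v > 0"
  using spd_pos[OF assms(2,1,3,4)] by (simp add: energy_norm_eq[OF assms(1-3)])

text \<open>The root is itself SPD, hence invertible, and K is a bound for its inverse. The estimate
  is used to bound the quotients in \<open>op_norm\<close> and, at the end, to pass from energy
  decay to Euclidean convergence.\<close>

lemma eucl_norm_le_energy_norm: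
  assumes A: "A \<in> carrier_mat n n" "spd A"
  obtains K where "K \<ge> 0" "\<And>v. v \<in> carrier_vec n \<Longrightarrow> eucl_norm v \<le> K * energy_norm A v"
proof -
  note R = spd_sqrt[OF A]
  note Ri = spd_inverse[OF R(2) R(1)]
  obtain K where K: "K \<ge> 0"
    "\<And>v. v \<in> carrier_vec n \<Longrightarrow> eucl_norm (matinv (spd_sqrt A) *\<^sub>v v) \<le> K * eucl_norm v"
    using eucl_norm_mult_mat_vec_bound[OF Ri(1)] by blast
  show thesis
  proof (rule that[OF K(1)])
    fix v :: "real vec" assume v: "v \<in> carrier_vec n"
    have "eucl_norm v = eucl_norm (matinv (spd_sqrt A) *\<^sub>v (spd_sqrt A *\<^sub>v v))"
      using spd_inverse_mult_vec(2)[OF R(2,1) v] by simp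
    also have "\<dots> \<le> K * energy_norm A v"
      unfolding energy_norm_def using R(2) v by (intro K(2)) simp
    finally show "eucl_norm v \<le> K * energy_norm A v" .
  qed
qed

lemma energy_norm_mult_mat_vec_bound:
  assumes B: "B \<in> carrier_mat n n" "spd B" and C: "C \<in> carrier_mat m m" "spd C"
    and S: "S \<in> carrier_mat m n"
  obtains K where "\<And>v. v \<in> carrier_vec n \<Longrightarrow> energy_norm C (S *\<^sub>v v) \<le> K * energy_norm B v"
proof -
  note R = spd_sqrt(2)[OF C]
  obtain K1 where K1: "K1 \<ge> 0" "\<And>v. v \<in> carrier_vec n \<Longrightarrow> eucl_norm v \<le> K1 * energy_norm B v"
    using eucl_norm_le_energy_norm[OF B] by blast
  have RS: "spd_sqrt C * S \<in> carrier_mat m n" using R S by simp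
  obtain K2 where K2: "K2 \<ge> 0"
    "\<And>v. v \<in> carrier_vec n \<Longrightarrow> eucl_norm ((spd_sqrt C * S) *\<^sub>v v) \<le> K2 * eucl_norm v"
    using eucl_norm_mult_mat_vec_bound[OF RS] by blast
  show thesis
  proof (rule that)
    fix v :: "real vec" assume v: "v \<in> carrier_vec n"
    have "energy_norm C (S *\<^sub>v v) = eucl_norm ((spd_sqrt C * S) *\<^sub>v v)"
      unfolding energy_norm_def assoc_mult_mat_vec[OF R S v] ..
    also have "\<dots> \<le> K2 * eucl_norm v" by (rule K2(2)[OF v])
    also have "\<dots> \<le> K2 * (K1 * energy_norm B v)" by (rule mult_left_mono[OF K1(2)[OF v] K2(1)])
    finally show "energy_norm C (S *\<^sub>v v) \<le> (K2 * K1) * energy_norm B v" by (simp add: mult.assoc)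
  qed
qed

text \<open>A real supremum dominates the members of its set only if the set is bounded above, which
  the preceding finite bound supplies. The zero vector is outside the set; there both sides
  vanish.\<close>

lemma energy_norm_le_op_norm:
  assumes B: "B \<in> carrier_mat n n" "spd B" and C: "C \<in> carrier_mat m m" "spd C"
    and S: "S \<in> carrier_mat m n" and v: "v \<in> carrier_vec n"
  shows "energy_norm C (S *\<^sub>v v) \<le> op_norm B C S * energy_norm B v"
proof (cases "v = 0\<^sub>v n")
  case True
  thus ?thesis by (simp add: mult_mat_vec_0[OF S] energy_norm_0[OF B] energy_norm_0[OF C])
next
  case False
  obtain K where K: "\<And>v. v \<in> carrier_vec n \<Longrightarrow> energy_norm C (S *\<^sub>v v) \<le> K * energy_norm B v"
    using energy_norm_mult_mat_vec_bound[OF B C S] by blast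
  have "energy_norm C (S *\<^sub>v v) / energy_norm B v \<le> op_norm B C S"
    unfolding op_norm_def
  proof (rule cSUP_upper)
    show "v \<in> {v \<in> carrier_vec (dim_col S). v \<noteq> 0\<^sub>v (dim_col S)}" using S v False by simp
    show "bdd_above ((\<lambda>v. energy_norm C (S *\<^sub>v v) / energy_norm B v) `
        {v \<in> carrier_vec (dim_col S). v \<noteq> 0\<^sub>v (dim_col S)})"
    proof (rule bdd_aboveI2)
      fix w :: "real vec" assume "w \<in> {v \<in> carrier_vec (dim_col S). v \<noteq> 0\<^sub>v (dim_col S)}"
      hence "w \<in> carrier_vec n" "w \<noteq> 0\<^sub>v n" using S by auto
      thus "energy_norm C (S *\<^sub>v w) / energy_norm B w \<le> K"
        using K energy_norm_pos[OF B] by (simp add: pos_divide_le_eq)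
    qed
  qed
  thus ?thesis using energy_norm_pos[OF B v False] by (simp add: pos_divide_le_eq)
qed

text \<open>Positivity of n provides a nonzero vector, so that the supremum is taken over a nonempty
  set.\<close>

lemma op_norm_le:
  assumes B: "B \<in> carrier_mat n n" "spd B" and S: "S \<in> carrier_mat m n" and n: "n > 0"
    and le: "\<And>v. v \<in> carrier_vec n \<Longrightarrow> energy_norm C (S *\<^sub>v v) \<le> K * energy_norm B v"
  shows "op_norm B C S \<le> K"
  unfolding op_norm_def
proof (rule cSUP_least)
  have "unit_vec n 0 \<in> carrier_vec n" "unit_vec n 0 \<noteq> (0\<^sub>v n :: real vec)"
    using n arg_cong[of "unit_vec n 0" "0\<^sub>v n :: real vec" "\<lambda>v. v $ 0"] by auto
  thus "{v \<in> carrier_vec (dim_col S). v \<noteq> (0\<^sub>v (dim_col S) :: real vec)} \<noteq> {}" using S by blast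
  fix w :: "real vec" assume "w \<in> {v \<in> carrier_vec (dim_col S). v \<noteq> 0\<^sub>v (dim_col S)}"
  hence "w \<in> carrier_vec n" "w \<noteq> 0\<^sub>v n" using S by auto
  thus "energy_norm C (S *\<^sub>v w) / energy_norm B w \<le> K"
    using le energy_norm_pos[OF B] by (simp add: pos_divide_le_eq)
qed

lemma op_norm_nonneg:
  assumes B: "B \<in> carrier_mat n n" "spd B" and C: "C \<in> carrier_mat m m" "spd C"
    and S: "S \<in> carrier_mat m n" and n: "n > 0"
  shows "op_norm B C S \<ge> 0"
proof -
  have u: "unit_vec n 0 \<in> carrier_vec n" "unit_vec n 0 \<noteq> (0\<^sub>v n :: real vec)"
    using n arg_cong[of "unit_vec n 0" "0\<^sub>v n :: real vec" "\<lambda>v. v $ 0"] by auto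
  have "0 \<le> op_norm B C S * energy_norm B (unit_vec n 0)"
    by (rule order_trans[OF energy_norm_nonneg energy_norm_le_op_norm[OF B C S u(1)]])
  thus ?thesis using energy_norm_pos[OF B u] by (simp add: zero_le_mult_iff)
qed

text \<open>A maximal independent set of columns has as many elements as the rank, here m, and the
  list of columns has length m. So the set contains every column and no column is repeated.
  Distinctness matters because linear independence is stated for sets, where a repetition would be
  invisible.\<close>

lemma injective_if_full_column_rank:
  fixes P :: "real mat"
  assumes P: "P \<in> carrier_mat n m" and rank: "vec_space.rank n P = m"
    and v: "v \<in> carrier_vec m" "P *\<^sub>v v = 0\<^sub>v n"
  shows "v = 0\<^sub>v m"
proof (rule ccontr)
  assume nz: "v \<noteq> 0\<^sub>v m"
  interpret vec_space "TYPE(real)" n .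
  obtain S where S: "maximal S (\<lambda>T. T \<subseteq> set (cols P) \<and> lin_indpt T)"
    using maximal_exists[of "\<lambda>T. T \<subseteq> set (cols P) \<and> lin_indpt T" "card (set (cols P))" "{}"]
    by (meson List.finite_set card_mono empty_iff empty_subsetI finite_lin_indpt2 rev_finite_subset)
  hence sub: "S \<subseteq> set (cols P)" and ind: "lin_indpt S" by (auto simp: maximal_def)
  have "card S = m" using rank_card_indpt[OF P S] rank by simp
  moreover have len: "length (cols P) = m" using P by simp
  ultimately have "card (set (cols P)) = m" "S = set (cols P)"
    using card_mono[OF List.finite_set sub] card_length[of "cols P"] card_subset_eq[OF List.finite_set sub]
    by auto
  hence "distinct (cols P)" using len by (simp add: card_distinct)
  from lin_depI[OF P v(1) nz v(2) this] show False using ind \<open>S = set (cols P)\<close> by simp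
qed

section \<open>The multigrid hierarchy\<close>

text \<open>Indices have the form \<open>Suc j\<close> to match the recursions of the cycle.
  Positive definiteness is required on every level and is derived from the finest level when the
  locale is interpreted; the contraction property of the smoothers enters later, as a premise of the
  estimate for S.\<close>

locale multigrid =
  fixes J :: nat and n :: "nat \<Rightarrow> nat" and A P M N :: "nat \<Rightarrow> real mat"
  assumes A_dim: "j \<le> J \<Longrightarrow> A j \<in> carrier_mat (n j) (n j)"
    and A_spd: "j \<le> J \<Longrightarrow> spd (A j)"
    and P_dim: "Suc j \<le> J \<Longrightarrow> P (Suc j) \<in> carrier_mat (n (Suc j)) (n j)"
    and M_dim: "Suc j \<le> J \<Longrightarrow> M (Suc j) \<in> carrier_mat (n (Suc j)) (n (Suc j))"
    and N_dim: "Suc j \<le> J \<Longrightarrow> N (Suc j) \<in> carrier_mat (n (Suc j)) (n (Suc j))"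
    and galerkin: "Suc j \<le> J \<Longrightarrow> A j = transpose_mat (P (Suc j)) * A (Suc j) * P (Suc j)"
begin

abbreviation smoothing :: "real mat \<Rightarrow> nat \<Rightarrow> real mat" where
  "smoothing R j \<equiv> 1\<^sub>m (n j) - R * A j"

lemma exact_solver_carrier: "exact_solver A \<in> carrier_vec (n 0) \<rightarrow> carrier_vec (n 0)"
  using spd_inverse(1)[OF A_dim A_spd, of 0] by (auto simp: exact_solver_def)

lemma residual_carrier:
  assumes "j \<le> J" "f \<in> carrier_vec (n j)" "v \<in> carrier_vec (n j)"
  shows "f - A j *\<^sub>v v \<in> carrier_vec (n j)"
  by (rule minus_carrier_vec[OF assms(2) mult_mat_vec_carrier[OF A_dim[OF assms(1)] assms(3)]])

lemma smoothing_step_carrier: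
  assumes "j \<le> J" "R \<in> carrier_mat (n j) (n j)" "f \<in> carrier_vec (n j)" "v \<in> carrier_vec (n j)"
  shows "v + R *\<^sub>v (f - A j *\<^sub>v v) \<in> carrier_vec (n j)"
  by (rule add_carrier_vec[OF assms(4) mult_mat_vec_carrier[OF assms(2) residual_carrier[OF assms(1,3,4)]]])

lemma restricted_residual_carrier:
  assumes "Suc j \<le> J" "f \<in> carrier_vec (n (Suc j))" "v \<in> carrier_vec (n (Suc j))"
  shows "transpose_mat (P (Suc j)) *\<^sub>v (f - A (Suc j) *\<^sub>v v) \<in> carrier_vec (n j)"
  using P_dim[OF assms(1)]
  by (intro mult_mat_vec_carrier[OF _ residual_carrier[OF assms]]) simp

lemma coarse_rhs_carrier:
  assumes "j \<le> J" "f \<in> carrier_vec (n j)" "v \<in> carrier_vec (n j)"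
  shows "coarse_rhs n A P M j f v \<in> carrier_vec (n 0)"
  using assms
proof (induction j arbitrary: f v)
  case (Suc j)
  show ?case unfolding coarse_rhs.simps Let_def
  proof (rule Suc.IH)
    show "j \<le> J" using Suc.prems(1) by simp
    show "transpose_mat (P (Suc j)) *\<^sub>v
        (f - A (Suc j) *\<^sub>v (v + M (Suc j) *\<^sub>v (f - A (Suc j) *\<^sub>v v))) \<in> carrier_vec (n j)"
      by (rule restricted_residual_carrier[OF Suc.prems(1,2)
            smoothing_step_carrier[OF Suc.prems(1) M_dim[OF Suc.prems(1)] Suc.prems(2,3)]])
  qed simp
qed simp

lemma vcycle_carrier:
  assumes "j \<le> J" "sol \<in> carrier_vec (n 0) \<rightarrow> carrier_vec (n 0)"
    "f \<in> carrier_vec (n j)" "v \<in> carrier_vec (n j)"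
  shows "vcycle n A P M N sol j f v \<in> carrier_vec (n j)"
  using assms
proof (induction j arbitrary: f v)
  case (Suc j)
  have j: "j \<le> J" using Suc.prems(1) by simp
  define v1 where "v1 = v + M (Suc j) *\<^sub>v (f - A (Suc j) *\<^sub>v v)"
  have v1: "v1 \<in> carrier_vec (n (Suc j))" unfolding v1_def
    by (rule smoothing_step_carrier[OF Suc.prems(1) M_dim[OF Suc.prems(1)] Suc.prems(3,4)])
  define v2 where "v2 = vcycle n A P M N sol j
      (transpose_mat (P (Suc j)) *\<^sub>v (f - A (Suc j) *\<^sub>v v1)) (0\<^sub>v (n j))"
  have v2: "v2 \<in> carrier_vec (n j)" unfolding v2_def
    by (rule Suc.IH[OF j Suc.prems(2) restricted_residual_carrier[OF Suc.prems(1,3) v1]]) simp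
  have v3: "v1 + P (Suc j) *\<^sub>v v2 \<in> carrier_vec (n (Suc j))"
    by (rule add_carrier_vec[OF v1 mult_mat_vec_carrier[OF P_dim[OF Suc.prems(1)] v2]])
  show ?case unfolding vcycle.simps Let_def v1_def[symmetric] v2_def[symmetric]
    by (rule smoothing_step_carrier[OF Suc.prems(1) N_dim[OF Suc.prems(1)] Suc.prems(3) v3])
qed auto

lemma smoothing_carrier:
  assumes "j \<le> J" "R \<in> carrier_mat (n j) (n j)"
  shows "smoothing R j \<in> carrier_mat (n j) (n j)"
  by (rule minus_carrier_mat[OF mult_carrier_mat[OF assms(2) A_dim[OF assms(1)]]])

lemma smoothed_prolongation_carrier:
  "j \<le> J \<Longrightarrow> smoothed_prolongation n A P N j \<in> carrier_mat (n j) (n 0)"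
proof (induction j)
  case (Suc j)
  have "j \<le> J" using Suc.prems by simp
  show ?case unfolding smoothed_prolongation.simps
    by (rule mult_carrier_mat[OF mult_carrier_mat[OF smoothing_carrier[OF Suc.prems N_dim[OF Suc.prems]]
          P_dim[OF Suc.prems]] Suc.IH[OF \<open>j \<le> J\<close>]])
qed simp

section \<open>Linear maps behind smoothing steps and V-cycles\<close>

lemma smoothing_mult_vec:
  assumes j: "j \<le> J" and R: "R \<in> carrier_mat (n j) (n j)" and v: "v \<in> carrier_vec (n j)"
  shows "smoothing R j *\<^sub>v v = v - R *\<^sub>v (A j *\<^sub>v v)"
proof -
  have "smoothing R j *\<^sub>v v = 1\<^sub>m (n j) *\<^sub>v v - (R * A j) *\<^sub>v v"
    using R A_dim[OF j] v by (intro minus_mult_distrib_mat_vec) auto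
  also have "(R * A j) *\<^sub>v v = R *\<^sub>v (A j *\<^sub>v v)"
    by (rule assoc_mult_mat_vec[OF R A_dim[OF j] v])
  finally show ?thesis using v by simp
qed

lemma smoothing_step_diff:
  assumes j: "j \<le> J" and R: "R \<in> carrier_mat (n j) (n j)"
    and f: "f \<in> carrier_vec (n j)" and v: "v \<in> carrier_vec (n j)" and w: "w \<in> carrier_vec (n j)"
  shows "(v + R *\<^sub>v (f - A j *\<^sub>v v)) - (w + R *\<^sub>v (f - A j *\<^sub>v w)) = smoothing R j *\<^sub>v (v - w)"
proof -
  note a = A_dim[OF j]
  have c: "A j *\<^sub>v v \<in> carrier_vec (n j)" "A j *\<^sub>v w \<in> carrier_vec (n j)" using a v w by auto
  define p q r where "p = R *\<^sub>v f" and "q = R *\<^sub>v (A j *\<^sub>v v)" and "r = R *\<^sub>v (A j *\<^sub>v w)"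
  have pqr: "p \<in> carrier_vec (n j)" "q \<in> carrier_vec (n j)" "r \<in> carrier_vec (n j)"
    using R f c by (auto simp: p_def q_def r_def)
  have "smoothing R j *\<^sub>v (v - w) = (v - w) - R *\<^sub>v (A j *\<^sub>v (v - w))"
    using v w by (intro smoothing_mult_vec[OF j R]) simp
  also have "R *\<^sub>v (A j *\<^sub>v (v - w)) = q - r"
    unfolding mult_minus_distrib_mat_vec[OF a v w] mult_minus_distrib_mat_vec[OF R c] q_def r_def ..
  also have "(v - w) - (q - r) = (v + (p - q)) - (w + (p - r))"
    using v w pqr by (intro eq_vecI) auto
  finally show ?thesis
    unfolding mult_minus_distrib_mat_vec[OF R f c(1)] mult_minus_distrib_mat_vec[OF R f c(2)]
    unfolding p_def q_def r_def ..
qed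

text \<open>The difference formula with one iterate equal to the solution x, which a smoothing step
  leaves fixed because its residual is zero.\<close>

lemma smoothing_step_error:
  assumes j: "j \<le> J" and R: "R \<in> carrier_mat (n j) (n j)"
    and x: "x \<in> carrier_vec (n j)" and v: "v \<in> carrier_vec (n j)"
  shows "x - (v + R *\<^sub>v (A j *\<^sub>v x - A j *\<^sub>v v)) = smoothing R j *\<^sub>v (x - v)"
proof -
  have Ax: "A j *\<^sub>v x \<in> carrier_vec (n j)" using A_dim[OF j] x by simp
  have "x + R *\<^sub>v (A j *\<^sub>v x - A j *\<^sub>v x) = x"
    using mult_mat_vec_0[OF R] Ax x by simp
  with smoothing_step_diff[OF j R Ax x v] show ?thesis by simp
qed

text \<open>Neither v1 nor the restricted residual involves the solver, so both cycles reach the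
  same coarse right-hand side. On the way up the common v1 cancels, and each level multiplies the
  difference by (I - N A) P, the factor that the recursion for S adds.\<close>

lemma vcycle_diff:
  assumes "j \<le> J" "sol \<in> carrier_vec (n 0) \<rightarrow> carrier_vec (n 0)"
    "sol' \<in> carrier_vec (n 0) \<rightarrow> carrier_vec (n 0)"
    "f \<in> carrier_vec (n j)" "v \<in> carrier_vec (n j)"
  shows "vcycle n A P M N sol j f v - vcycle n A P M N sol' j f v =
    smoothed_prolongation n A P N j *\<^sub>v
      (sol (coarse_rhs n A P M j f v) - sol' (coarse_rhs n A P M j f v))"
  using assms
proof (induction j arbitrary: f v)
  case 0
  hence "sol f - sol' f \<in> carrier_vec (n 0)" by (intro minus_carrier_vec) auto
  thus ?case by simp
next
  case (Suc j)
  note a = A_dim[OF Suc.prems(1)] and p = P_dim[OF Suc.prems(1)] and m = M_dim[OF Suc.prems(1)]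
    and nn = N_dim[OF Suc.prems(1)] and sols = Suc.prems(2,3) and f = Suc.prems(4) and v = Suc.prems(5)
  have j: "j \<le> J" using Suc.prems(1) by simp
  define v1 where "v1 = v + M (Suc j) *\<^sub>v (f - A (Suc j) *\<^sub>v v)"
  have v1: "v1 \<in> carrier_vec (n (Suc j))"
    unfolding v1_def by (rule smoothing_step_carrier[OF Suc.prems(1) m f v])
  define f' where "f' = transpose_mat (P (Suc j)) *\<^sub>v (f - A (Suc j) *\<^sub>v v1)"
  have f': "f' \<in> carrier_vec (n j)"
    unfolding f'_def by (rule restricted_residual_carrier[OF Suc.prems(1) f v1])
  define w where "w s = vcycle n A P M N s j f' (0\<^sub>v (n j))" for s
  have w: "w sol \<in> carrier_vec (n j)" "w sol' \<in> carrier_vec (n j)"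
    unfolding w_def using sols f' by (auto intro!: vcycle_carrier[OF j])
  have Pw: "P (Suc j) *\<^sub>v w sol \<in> carrier_vec (n (Suc j))" "P (Suc j) *\<^sub>v w sol' \<in> carrier_vec (n (Suc j))"
    using p w by auto
  define d where "d = sol (coarse_rhs n A P M j f' (0\<^sub>v (n j))) - sol' (coarse_rhs n A P M j f' (0\<^sub>v (n j)))"
  have "coarse_rhs n A P M j f' (0\<^sub>v (n j)) \<in> carrier_vec (n 0)"
    using f' by (intro coarse_rhs_carrier[OF j]) auto
  hence d: "d \<in> carrier_vec (n 0)" unfolding d_def using sols by (intro minus_carrier_vec) auto
  note S = smoothed_prolongation_carrier[OF j]
  note G = smoothing_carrier[OF Suc.prems(1) nn]
  have IH: "w sol - w sol' = smoothed_prolongation n A P N j *\<^sub>v d"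
    unfolding w_def d_def using f' by (intro Suc.IH[OF j sols]) auto
  have "vcycle n A P M N sol (Suc j) f v - vcycle n A P M N sol' (Suc j) f v =
      smoothing (N (Suc j)) (Suc j) *\<^sub>v ((v1 + P (Suc j) *\<^sub>v w sol) - (v1 + P (Suc j) *\<^sub>v w sol'))"
    unfolding vcycle.simps Let_def v1_def[symmetric] f'_def[symmetric] w_def[symmetric]
    using v1 Pw f by (intro smoothing_step_diff[OF Suc.prems(1) nn]) auto
  also have "(v1 + P (Suc j) *\<^sub>v w sol) - (v1 + P (Suc j) *\<^sub>v w sol') = P (Suc j) *\<^sub>v w sol - P (Suc j) *\<^sub>v w sol'"
    using v1 Pw by (intro eq_vecI) auto
  also have "\<dots> = P (Suc j) *\<^sub>v (smoothed_prolongation n A P N j *\<^sub>v d)"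
    unfolding IH[symmetric] by (rule mult_minus_distrib_mat_vec[OF p w, symmetric])
  also have "smoothing (N (Suc j)) (Suc j) *\<^sub>v \<dots> = (smoothing (N (Suc j)) (Suc j) * P (Suc j)) *\<^sub>v (smoothed_prolongation n A P N j *\<^sub>v d)"
    using S d by (intro assoc_mult_mat_vec[OF G p, symmetric]) simp
  also have "\<dots> = smoothed_prolongation n A P N (Suc j) *\<^sub>v d"
    unfolding smoothed_prolongation.simps
    by (rule assoc_mult_mat_vec[OF mult_carrier_mat[OF G p] S d, symmetric])
  finally show ?case
    unfolding d_def coarse_rhs.simps Let_def v1_def[symmetric] f'_def[symmetric] .
qed

text \<open>Writing the right-hand side as \<open>A j *\<^sub>v x\<close> names the solution on each
  level. The matrices obey E = (I - N A) (I - P (I - E') C P^T A) (I - M A), where E' belongs to the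
  next coarser level and C is the inverse of its system matrix.\<close>

lemma exact_vcycle_error:
  assumes "j \<le> J"
  shows "\<exists>E \<in> carrier_mat (n j) (n j). \<forall>x \<in> carrier_vec (n j). \<forall>v \<in> carrier_vec (n j).
    x - vcycle n A P M N (exact_solver A) j (A j *\<^sub>v x) v = E *\<^sub>v (x - v)"
  using assms
proof (induction j)
  case 0
  show ?case
  \<comment> \<open>The exact coarsest solve leaves no error, whatever the initial vector.\<close>
  proof (intro bexI[of _ "0\<^sub>m (n 0) (n 0)"] ballI)
    fix x v :: "real vec" assume xv: "x \<in> carrier_vec (n 0)" "v \<in> carrier_vec (n 0)"
    have "vcycle n A P M N (exact_solver A) 0 (A 0 *\<^sub>v x) v = x"
      using spd_inverse_mult_vec(2)[OF A_dim A_spd xv(1)] by (simp add: exact_solver_def)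
    thus "x - vcycle n A P M N (exact_solver A) 0 (A 0 *\<^sub>v x) v = 0\<^sub>m (n 0) (n 0) *\<^sub>v (x - v)"
      using xv by auto
  qed simp
next
  case (Suc j)
  note a = A_dim[OF Suc.prems] and p = P_dim[OF Suc.prems] and m = M_dim[OF Suc.prems]
    and nn = N_dim[OF Suc.prems]
  have j: "j \<le> J" using Suc.prems by simp
  have pt: "transpose_mat (P (Suc j)) \<in> carrier_mat (n j) (n (Suc j))" using p by simp
  note C = spd_inverse(1)[OF A_dim[OF j] A_spd[OF j]]
  obtain E' where E': "E' \<in> carrier_mat (n j) (n j)"
    and err: "\<And>x v. x \<in> carrier_vec (n j) \<Longrightarrow> v \<in> carrier_vec (n j) \<Longrightarrow>
      x - vcycle n A P M N (exact_solver A) j (A j *\<^sub>v x) v = E' *\<^sub>v (x - v)"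
    using Suc.IH[OF j] by blast
  \<comment> \<open>T maps a fine error to the solution of the coarse problem, that is, to the
    coefficients of its A-orthogonal projection onto the range of P.\<close>
  define T where "T = matinv (A j) * (transpose_mat (P (Suc j)) * A (Suc j))"
  have T: "T \<in> carrier_mat (n j) (n (Suc j))" unfolding T_def
    by (rule mult_carrier_mat[OF C mult_carrier_mat[OF pt a]])
  \<comment> \<open>Started from zero, the coarse cycle returns c - E' c in place of the exact
    correction c; F is this map.\<close>
  define F where "F = 1\<^sub>m (n j) - E'"
  have F: "F \<in> carrier_mat (n j) (n j)" unfolding F_def using E' by (rule minus_carrier_mat)
  define K where "K = 1\<^sub>m (n (Suc j)) - P (Suc j) * (F * T)"
  have PFT: "P (Suc j) * (F * T) \<in> carrier_mat (n (Suc j)) (n (Suc j))"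
    by (rule mult_carrier_mat[OF p mult_carrier_mat[OF F T]])
  have K: "K \<in> carrier_mat (n (Suc j)) (n (Suc j))" unfolding K_def using PFT by (rule minus_carrier_mat)
  note GN = smoothing_carrier[OF Suc.prems nn] and GM = smoothing_carrier[OF Suc.prems m]
  show ?case
  proof (intro bexI[of _ "smoothing (N (Suc j)) (Suc j) * (K * smoothing (M (Suc j)) (Suc j))"] ballI)
    show "smoothing (N (Suc j)) (Suc j) * (K * smoothing (M (Suc j)) (Suc j)) \<in> carrier_mat (n (Suc j)) (n (Suc j))"
      by (rule mult_carrier_mat[OF GN mult_carrier_mat[OF K GM]])
    fix x v :: "real vec" assume x: "x \<in> carrier_vec (n (Suc j))" and v: "v \<in> carrier_vec (n (Suc j))"
    define f where "f = A (Suc j) *\<^sub>v x"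
    have f: "f \<in> carrier_vec (n (Suc j))" unfolding f_def by (rule mult_mat_vec_carrier[OF a x])
    have xv: "x - v \<in> carrier_vec (n (Suc j))" using x v by simp
    define v1 where "v1 = v + M (Suc j) *\<^sub>v (f - A (Suc j) *\<^sub>v v)"
    have v1: "v1 \<in> carrier_vec (n (Suc j))"
      unfolding v1_def by (rule smoothing_step_carrier[OF Suc.prems m f v])
    define e1 where "e1 = x - v1"
    have e1: "e1 \<in> carrier_vec (n (Suc j))" unfolding e1_def using x v1 by simp
    have e1_eq: "e1 = smoothing (M (Suc j)) (Suc j) *\<^sub>v (x - v)"
      unfolding e1_def v1_def f_def by (rule smoothing_step_error[OF Suc.prems m x v])
    define f' where "f' = transpose_mat (P (Suc j)) *\<^sub>v (f - A (Suc j) *\<^sub>v v1)"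
    define c where "c = T *\<^sub>v e1"
    have c: "c \<in> carrier_vec (n j)" unfolding c_def by (rule mult_mat_vec_carrier[OF T e1])
    \<comment> \<open>The restricted residual takes the form \<open>A j *\<^sub>v c\<close>, to
      which the induction hypothesis applies with c as the exact solution.\<close>
    have f'_eq: "f' = A j *\<^sub>v c"
    proof -
      have Ae: "transpose_mat (P (Suc j)) *\<^sub>v (A (Suc j) *\<^sub>v e1) \<in> carrier_vec (n j)"
        by (rule mult_mat_vec_carrier[OF pt mult_mat_vec_carrier[OF a e1]])
      have "f' = transpose_mat (P (Suc j)) *\<^sub>v (A (Suc j) *\<^sub>v e1)"
        unfolding f'_def f_def e1_def mult_minus_distrib_mat_vec[OF a x v1] ..
      moreover have "c = matinv (A j) *\<^sub>v (transpose_mat (P (Suc j)) *\<^sub>v (A (Suc j) *\<^sub>v e1))"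
        unfolding c_def T_def assoc_mult_mat_vec[OF C mult_carrier_mat[OF pt a] e1]
          assoc_mult_mat_vec[OF pt a e1] ..
      ultimately show ?thesis
        using spd_inverse_mult_vec(1)[OF A_dim[OF j] A_spd[OF j] Ae] by simp
    qed
    define v2 where "v2 = vcycle n A P M N (exact_solver A) j f' (0\<^sub>v (n j))"
    have v2: "v2 \<in> carrier_vec (n j)"
      unfolding v2_def f'_eq
      by (intro vcycle_carrier[OF j exact_solver_carrier] mult_mat_vec_carrier[OF A_dim[OF j] c]) simp
    have c_v2: "c - v2 = E' *\<^sub>v c"
      unfolding v2_def f'_eq using err[OF c, of "0\<^sub>v (n j)"] c by simp
    have "v2 = c - (c - v2)" using c v2 by (intro eq_vecI) auto
    also have "\<dots> = c - E' *\<^sub>v c" unfolding c_v2 ..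
    also have "\<dots> = F *\<^sub>v c"
      unfolding F_def using minus_mult_distrib_mat_vec[OF one_carrier_mat E' c] c by simp
    also have "\<dots> = (F * T) *\<^sub>v e1" unfolding c_def by (rule assoc_mult_mat_vec[OF F T e1, symmetric])
    finally have v2_eq: "P (Suc j) *\<^sub>v v2 = (P (Suc j) * (F * T)) *\<^sub>v e1"
      by (simp only: assoc_mult_mat_vec[OF p mult_carrier_mat[OF F T] e1])
    define v3 where "v3 = v1 + P (Suc j) *\<^sub>v v2"
    have Pv2: "P (Suc j) *\<^sub>v v2 \<in> carrier_vec (n (Suc j))" by (rule mult_mat_vec_carrier[OF p v2])
    have v3: "v3 \<in> carrier_vec (n (Suc j))" unfolding v3_def using v1 Pv2 by simp
    have "x - v3 = e1 - P (Suc j) *\<^sub>v v2"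
      unfolding v3_def e1_def using x v1 Pv2 p by (intro eq_vecI) auto
    also have "\<dots> = K *\<^sub>v e1"
      unfolding v2_eq K_def using minus_mult_distrib_mat_vec[OF one_carrier_mat PFT e1] e1 by simp
    finally have x_v3: "x - v3 = K *\<^sub>v e1" .
    have "x - vcycle n A P M N (exact_solver A) (Suc j) f v
        = x - (v3 + N (Suc j) *\<^sub>v (f - A (Suc j) *\<^sub>v v3))"
      unfolding vcycle.simps Let_def v1_def[symmetric] f'_def[symmetric] v2_def[symmetric] v3_def[symmetric] ..
    also have "\<dots> = smoothing (N (Suc j)) (Suc j) *\<^sub>v (x - v3)"
      unfolding f_def by (rule smoothing_step_error[OF Suc.prems nn x v3])
    also have "\<dots> = smoothing (N (Suc j)) (Suc j) *\<^sub>v (K *\<^sub>v (smoothing (M (Suc j)) (Suc j) *\<^sub>v (x - v)))"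
      unfolding x_v3 e1_eq ..
    also have "\<dots> = (smoothing (N (Suc j)) (Suc j) * (K * smoothing (M (Suc j)) (Suc j))) *\<^sub>v (x - v)"
      unfolding assoc_mult_mat_vec[OF GN mult_carrier_mat[OF K GM] xv] assoc_mult_mat_vec[OF K GM xv] ..
    finally show "x - vcycle n A P M N (exact_solver A) (Suc j) (A (Suc j) *\<^sub>v x) v
        = smoothing (N (Suc j)) (Suc j) * (K * smoothing (M (Suc j)) (Suc j)) *\<^sub>v (x - v)"
      unfolding f_def .
  qed
qed

text \<open>Existence comes from \<open>exact_vcycle_error\<close>. For uniqueness, every vector e
  occurs as a starting error, namely for right-hand side A e and initial vector 0, so two candidates
  agree on all vectors.\<close>

lemma error_propagation_matrix:
  "error_propagation_matrix J n A P M N \<in> carrier_mat (n J) (n J)"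
  "b \<in> carrier_vec (n J) \<Longrightarrow> y \<in> carrier_vec (n J) \<Longrightarrow>
    matinv (A J) *\<^sub>v b - vcycle n A P M N (exact_solver A) J b y
      = error_propagation_matrix J n A P M N *\<^sub>v (matinv (A J) *\<^sub>v b - y)"
proof -
  let ?P = "\<lambda>E. E \<in> carrier_mat (n J) (n J) \<and>
        (\<forall>b \<in> carrier_vec (n J). \<forall>y \<in> carrier_vec (n J).
           matinv (A J) *\<^sub>v b - vcycle n A P M N (exact_solver A) J b y
             = E *\<^sub>v (matinv (A J) *\<^sub>v b - y))"
  note a = A_dim[OF order_refl] A_spd[OF order_refl]
  note C = spd_inverse(1)[OF a]
  obtain E where E: "E \<in> carrier_mat (n J) (n J)"
    and err: "\<And>x v. x \<in> carrier_vec (n J) \<Longrightarrow> v \<in> carrier_vec (n J) \<Longrightarrow>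
      x - vcycle n A P M N (exact_solver A) J (A J *\<^sub>v x) v = E *\<^sub>v (x - v)"
    using exact_vcycle_error[OF order_refl] by blast
  have PE: "?P E"
  proof (intro conjI E ballI)
    fix b y :: "real vec" assume b: "b \<in> carrier_vec (n J)" and y: "y \<in> carrier_vec (n J)"
    show "matinv (A J) *\<^sub>v b - vcycle n A P M N (exact_solver A) J b y = E *\<^sub>v (matinv (A J) *\<^sub>v b - y)"
      using err[OF mult_mat_vec_carrier[OF C b] y] unfolding spd_inverse_mult_vec(1)[OF a b] .
  qed
  have unique: "E' = E" if E': "?P E'" for E'
  proof (rule mat_eq_by_mult_vec[OF conjunct1[OF E'] E])
    fix e :: "real vec" assume e: "e \<in> carrier_vec (n J)"
    let ?b = "A J *\<^sub>v e"
    have b: "?b \<in> carrier_vec (n J)" by (rule mult_mat_vec_carrier[OF a(1) e])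
    have e0: "matinv (A J) *\<^sub>v ?b - 0\<^sub>v (n J) = e"
      using spd_inverse_mult_vec(2)[OF a e] e by simp
    have "E' *\<^sub>v (matinv (A J) *\<^sub>v ?b - 0\<^sub>v (n J)) = E *\<^sub>v (matinv (A J) *\<^sub>v ?b - 0\<^sub>v (n J))"
      using conjunct2[OF E', rule_format, OF b zero_carrier_vec]
        conjunct2[OF PE, rule_format, OF b zero_carrier_vec] by (rule trans[OF sym])
    thus "E' *\<^sub>v e = E *\<^sub>v e" unfolding e0 .
  qed
  have P: "?P (error_propagation_matrix J n A P M N)"
    unfolding error_propagation_matrix_def by (rule theI[where P = ?P, OF PE unique])
  show "error_propagation_matrix J n A P M N \<in> carrier_mat (n J) (n J)" by (rule conjunct1[OF P])
  show "matinv (A J) *\<^sub>v b - vcycle n A P M N (exact_solver A) J b y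
      = error_propagation_matrix J n A P M N *\<^sub>v (matinv (A J) *\<^sub>v b - y)"
    if "b \<in> carrier_vec (n J)" "y \<in> carrier_vec (n J)"
    using conjunct2[OF P, rule_format, OF that] .
qed

section \<open>Energy norm estimates for one cycle\<close>

lemma energy_norm_prolongation:
  assumes j: "Suc j \<le> J" and v: "v \<in> carrier_vec (n j)"
  shows "energy_norm (A (Suc j)) (P (Suc j) *\<^sub>v v) = energy_norm (A j) v"
proof -
  note a = A_dim[OF j] and p = P_dim[OF j]
  have pt: "transpose_mat (P (Suc j)) \<in> carrier_mat (n j) (n (Suc j))" using p by simp
  have j': "j \<le> J" using j by simp
  have Pv: "P (Suc j) *\<^sub>v v \<in> carrier_vec (n (Suc j))" by (rule mult_mat_vec_carrier[OF p v])
  have APv: "A (Suc j) *\<^sub>v (P (Suc j) *\<^sub>v v) \<in> carrier_vec (n (Suc j))" by (rule mult_mat_vec_carrier[OF a Pv])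
  have "v \<bullet> (A j *\<^sub>v v) = v \<bullet> (transpose_mat (P (Suc j)) *\<^sub>v (A (Suc j) *\<^sub>v (P (Suc j) *\<^sub>v v)))"
    unfolding galerkin[OF j] assoc_mult_mat_vec[OF mult_carrier_mat[OF pt a] p v]
      assoc_mult_mat_vec[OF pt a Pv] ..
  also have "\<dots> = (transpose_mat (P (Suc j)) *\<^sub>v (A (Suc j) *\<^sub>v (P (Suc j) *\<^sub>v v))) \<bullet> v"
    by (rule comm_scalar_prod[OF v mult_mat_vec_carrier[OF pt APv]])
  also have "\<dots> = (A (Suc j) *\<^sub>v (P (Suc j) *\<^sub>v v)) \<bullet> (P (Suc j) *\<^sub>v v)"
    by (rule transpose_vec_mult_scalar[OF p v APv])
  also have "\<dots> = (P (Suc j) *\<^sub>v v) \<bullet> (A (Suc j) *\<^sub>v (P (Suc j) *\<^sub>v v))"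
    by (rule comm_scalar_prod[OF APv Pv])
  finally show ?thesis
    by (simp only: energy_norm_eq[OF A_dim[OF j'] A_spd[OF j'] v] energy_norm_eq[OF a A_spd[OF j] Pv])
qed

text \<open>The premise on N is a pointwise non-strict inequality, so that it covers both a
  convergent smoother and the absence of post-smoothing.\<close>

lemma energy_norm_smoothed_prolongation_le:
  assumes N_contr: "\<And>j v. Suc j \<le> J \<Longrightarrow> v \<in> carrier_vec (n (Suc j)) \<Longrightarrow>
      energy_norm (A (Suc j)) (smoothing (N (Suc j)) (Suc j) *\<^sub>v v) \<le> energy_norm (A (Suc j)) v"
    and j: "j \<le> J" and v: "v \<in> carrier_vec (n 0)"
  shows "energy_norm (A j) (smoothed_prolongation n A P N j *\<^sub>v v) \<le> energy_norm (A 0) v"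
  using j
proof (induction j)
  case 0
  show ?case using v by simp
next
  case (Suc j)
  have j: "j \<le> J" using Suc.prems by simp
  note p = P_dim[OF Suc.prems] and G = smoothing_carrier[OF Suc.prems N_dim[OF Suc.prems]]
    and S = smoothed_prolongation_carrier[OF j]
  let ?w = "smoothed_prolongation n A P N j *\<^sub>v v"
  have w: "?w \<in> carrier_vec (n j)" by (rule mult_mat_vec_carrier[OF S v])
  have "smoothed_prolongation n A P N (Suc j) *\<^sub>v v = smoothing (N (Suc j)) (Suc j) *\<^sub>v (P (Suc j) *\<^sub>v ?w)"
    unfolding smoothed_prolongation.simps assoc_mult_mat_vec[OF mult_carrier_mat[OF G p] S v]
      assoc_mult_mat_vec[OF G p w] ..
  also have "energy_norm (A (Suc j)) \<dots> \<le> energy_norm (A (Suc j)) (P (Suc j) *\<^sub>v ?w)"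
    by (rule N_contr[OF Suc.prems mult_mat_vec_carrier[OF p w]])
  also have "\<dots> = energy_norm (A j) ?w" by (rule energy_norm_prolongation[OF Suc.prems w])
  also have "\<dots> \<le> energy_norm (A 0) v" by (rule Suc.IH[OF j])
  finally show ?case .
qed

lemma inexact_vcycle_deviation:
  assumes b: "b \<in> carrier_vec (n J)" and y: "y \<in> carrier_vec (n J)"
    and sol: "sol \<in> carrier_vec (n 0) \<rightarrow> carrier_vec (n 0)"
    and n0: "n 0 > 0"
    and bound: "coarse_error_bound J n A P M b sol \<gamma> y"
  shows "energy_norm (A J) (vcycle n A P M N (exact_solver A) J b y - vcycle n A P M N sol J b y)
    \<le> op_norm (A 0) (A J) (smoothed_prolongation n A P N J) * \<gamma> * energy_norm (A J) (matinv (A J) *\<^sub>v b - y)"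
proof -
  note a = A_dim[OF order_refl] A_spd[OF order_refl] and a0 = A_dim[OF le0] A_spd[OF le0]
    and S = smoothed_prolongation_carrier[OF order_refl]
  let ?f = "coarse_rhs n A P M J b y"
  have f: "?f \<in> carrier_vec (n 0)" by (rule coarse_rhs_carrier[OF order_refl b y])
  have d: "exact_solver A ?f - sol ?f \<in> carrier_vec (n 0)"
    using f sol exact_solver_carrier by (intro minus_carrier_vec) auto
  have "energy_norm (A J) (vcycle n A P M N (exact_solver A) J b y - vcycle n A P M N sol J b y)
      \<le> op_norm (A 0) (A J) (smoothed_prolongation n A P N J) * energy_norm (A 0) (exact_solver A ?f - sol ?f)"
    unfolding vcycle_diff[OF order_refl exact_solver_carrier sol b y]
    by (rule energy_norm_le_op_norm[OF a0 a S d])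
  \<comment> \<open>Inserting the coarse error bound multiplies it by the norm of S, whose
    nonnegativity rests on \<open>n 0 > 0\<close>.\<close>
  also have "\<dots> \<le> op_norm (A 0) (A J) (smoothed_prolongation n A P N J) *
      (\<gamma> * energy_norm (A J) (matinv (A J) *\<^sub>v b - y))"
    using bound unfolding coarse_error_bound_def Let_def
    by (rule mult_left_mono[OF _ op_norm_nonneg[OF a0 a S n0]])
  finally show ?thesis by (simp add: mult.assoc)
qed

lemma inexact_vcycle_error:
  assumes b: "b \<in> carrier_vec (n J)" and y: "y \<in> carrier_vec (n J)"
    and sol: "sol \<in> carrier_vec (n 0) \<rightarrow> carrier_vec (n 0)"
    and n0: "n 0 > 0"
    and bound: "coarse_error_bound J n A P M b sol \<gamma> y"
  shows "energy_norm (A J) (matinv (A J) *\<^sub>v b - vcycle n A P M N sol J b y)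
    \<le> (op_norm (A J) (A J) (error_propagation_matrix J n A P M N)
        + op_norm (A 0) (A J) (smoothed_prolongation n A P N J) * \<gamma>)
      * energy_norm (A J) (matinv (A J) *\<^sub>v b - y)"
proof -
  note a = A_dim[OF order_refl] A_spd[OF order_refl]
  let ?x = "matinv (A J) *\<^sub>v b"
  have x: "?x \<in> carrier_vec (n J)" by (rule mult_mat_vec_carrier[OF spd_inverse(1)[OF a] b])
  let ?ex = "vcycle n A P M N (exact_solver A) J b y" and ?inx = "vcycle n A P M N sol J b y"
  have ex: "?ex \<in> carrier_vec (n J)" by (rule vcycle_carrier[OF order_refl exact_solver_carrier b y])
  have inx: "?inx \<in> carrier_vec (n J)" by (rule vcycle_carrier[OF order_refl sol b y])
  have split: "?x - ?inx = (?x - ?ex) + (?ex - ?inx)" using x ex inx by (intro eq_vecI) auto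
  have xy: "?x - y \<in> carrier_vec (n J)" by (rule minus_carrier_vec[OF x y])
  have "energy_norm (A J) (?x - ?inx) \<le> energy_norm (A J) (?x - ?ex) + energy_norm (A J) (?ex - ?inx)"
    unfolding split
    by (rule energy_norm_triangle[OF a minus_carrier_vec[OF x ex] minus_carrier_vec[OF ex inx]])
  moreover have "energy_norm (A J) (?x - ?ex)
      \<le> op_norm (A J) (A J) (error_propagation_matrix J n A P M N) * energy_norm (A J) (?x - y)"
    unfolding error_propagation_matrix(2)[OF b y]
    by (rule energy_norm_le_op_norm[OF a a error_propagation_matrix(1) xy])
  ultimately show ?thesis
    using inexact_vcycle_deviation[OF assms] unfolding distrib_right by linarith
qed

end

section \<open>From the hypotheses on the hierarchy to the theorem\<close>

text \<open>Induction downwards from the finest level: full column rank makes the prolongation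
  injective, so the Galerkin product is a congruence that preserves positive definiteness.\<close>

lemma spd_galerkin_levels:
  fixes n :: "nat \<Rightarrow> nat" and A P :: "nat \<Rightarrow> real mat"
  assumes A_dim: "\<And>j. j \<le> J \<Longrightarrow> A j \<in> carrier_mat (n j) (n j)"
    and A_spd: "spd (A J)"
    and P_dim: "\<And>j. Suc j \<le> J \<Longrightarrow> P (Suc j) \<in> carrier_mat (n (Suc j)) (n j)"
    and P_rank: "\<And>j. Suc j \<le> J \<Longrightarrow> vec_space.rank (n (Suc j)) (P (Suc j)) = n j"
    and galerkin: "\<And>j. Suc j \<le> J \<Longrightarrow> A j = transpose_mat (P (Suc j)) * A (Suc j) * P (Suc j)"
    and j: "j \<le> J"
  shows "spd (A j)"
  using j
proof (induction rule: inc_induct)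
  case base
  show ?case by (rule A_spd)
next
  case (step j)
  hence j: "Suc j \<le> J" by simp
  show ?case unfolding galerkin[OF j]
    by (rule spd_congruence[OF A_dim[OF j] step.IH P_dim[OF j]
          injective_if_full_column_rank[OF P_dim[OF j] P_rank[OF j]]])
qed

lemma smoother_carrier:
  assumes "convergent_smoother J n A R \<or> no_smoother J n R" "Suc j \<le> J"
  shows "R (Suc j) \<in> carrier_mat (n (Suc j)) (n (Suc j))"
  using assms by (auto simp: convergent_smoother_def no_smoother_def)

text \<open>A convergent smoother has norm below 1. For the zero smoother the matrix is the identity
  and equality holds, hence the non-strict form.\<close>

lemma smoother_energy_norm_le:
  assumes R: "convergent_smoother J n A R \<or> no_smoother J n R" and j: "Suc j \<le> J"
    and a: "A (Suc j) \<in> carrier_mat (n (Suc j)) (n (Suc j))" "spd (A (Suc j))"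
    and v: "v \<in> carrier_vec (n (Suc j))"
  shows "energy_norm (A (Suc j)) ((1\<^sub>m (n (Suc j)) - R (Suc j) * A (Suc j)) *\<^sub>v v) \<le> energy_norm (A (Suc j)) v"
  using R
proof
  assume "convergent_smoother J n A R"
  hence less: "op_norm (A (Suc j)) (A (Suc j)) (1\<^sub>m (n (Suc j)) - R (Suc j) * A (Suc j)) < 1"
    using j by (auto simp: convergent_smoother_def)
  have G: "1\<^sub>m (n (Suc j)) - R (Suc j) * A (Suc j) \<in> carrier_mat (n (Suc j)) (n (Suc j))"
    by (rule minus_carrier_mat[OF mult_carrier_mat[OF smoother_carrier[OF R j] a(1)]])
  show ?thesis
    using energy_norm_le_op_norm[OF a a G v]
      mult_right_mono[OF less_imp_le[OF less] energy_norm_nonneg[of "A (Suc j)" v]] by linarith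
next
  assume "no_smoother J n R"
  hence R0: "R (Suc j) = 0\<^sub>m (n (Suc j)) (n (Suc j))" using j by (auto simp: no_smoother_def)
  have "1\<^sub>m (n (Suc j)) - R (Suc j) * A (Suc j) = 1\<^sub>m (n (Suc j))"
    unfolding R0 using a(1) by (intro eq_matI) auto
  thus ?thesis using v by simp
qed

theorem theorem3p1:
  fixes J :: nat and n :: "nat \<Rightarrow> nat"
    and A P M N :: "nat \<Rightarrow> real mat"
    and b x :: "real vec" and E S :: "real mat"
  assumes J: "J \<ge> 1"
    and n: "\<And>j. j \<le> J \<Longrightarrow> n j > 0"
    and A_dim: "\<And>j. j \<le> J \<Longrightarrow> A j \<in> carrier_mat (n j) (n j)"
    and A_spd: "spd (A J)"
    and P_dim: "\<And>j. j \<in> {1..J} \<Longrightarrow> P j \<in> carrier_mat (n j) (n (j - 1))"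
    and P_rank: "\<And>j. j \<in> {1..J} \<Longrightarrow> vec_space.rank (n j) (P j) = n (j - 1)"
    and galerkin: "\<And>j. j \<in> {1..J} \<Longrightarrow> A (j - 1) = transpose_mat (P j) * A j * P j"
    and smoothers:
      "(convergent_smoother J n A M \<and> convergent_smoother J n A N) \<or>
       (no_smoother J n M \<and> convergent_smoother J n A N) \<or>
       (convergent_smoother J n A M \<and> no_smoother J n N)"
    and b: "b \<in> carrier_vec (n J)"
    and x: "x = matinv (A J) *\<^sub>v b"
    and E: "E = error_propagation_matrix J n A P M N"
    and E_lt_1: "op_norm (A J) (A J) E < 1"
    and S: "S = smoothed_prolongation n A P N J"
  shows
    "op_norm (A 0) (A J) S \<le> 1
     \<and> (\<forall>x_prev \<in> carrier_vec (n J). \<forall>sol \<in> carrier_vec (n 0) \<rightarrow> carrier_vec (n 0). \<forall>\<gamma> > 0.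
          coarse_error_bound J n A P M b sol \<gamma> x_prev \<longrightarrow>
          (let x_ex = vcycle n A P M N (exact_solver A) J b x_prev;
               x_in = vcycle n A P M N sol J b x_prev
           in (x_prev \<noteq> x \<longrightarrow>
                 energy_norm (A J) (x_ex - x_in) / energy_norm (A J) (x - x_prev)
                   \<le> op_norm (A 0) (A J) S * \<gamma>)
            \<and> energy_norm (A J) (x - x_in)
                \<le> (op_norm (A J) (A J) E + op_norm (A 0) (A J) S * \<gamma>)
                  * energy_norm (A J) (x - x_prev)))
     \<and> (\<forall>sol \<gamma>. \<gamma> > 0 \<longrightarrow>
          (\<forall>k. \<forall>y \<in> carrier_vec (n J).
             sol k y \<in> carrier_vec (n 0) \<rightarrow> carrier_vec (n 0) \<and>
             coarse_error_bound J n A P M b (sol k y) \<gamma> y) \<longrightarrow>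
          op_norm (A J) (A J) E + op_norm (A 0) (A J) S * \<gamma> < 1 \<longrightarrow>
          (\<forall>x0 \<in> carrier_vec (n J).
             (\<lambda>k. eucl_norm (x - inV_iterates J n A P M N b sol x0 k)) \<longlonglongrightarrow> 0))"
proof -
  have P_dim': "P (Suc j) \<in> carrier_mat (n (Suc j)) (n j)" if "Suc j \<le> J" for j
    using P_dim[of "Suc j"] that by simp
  have P_rank': "vec_space.rank (n (Suc j)) (P (Suc j)) = n j" if "Suc j \<le> J" for j
    using P_rank[of "Suc j"] that by simp
  have galerkin': "A j = transpose_mat (P (Suc j)) * A (Suc j) * P (Suc j)" if "Suc j \<le> J" for j
    using galerkin[of "Suc j"] that by simp
  have M: "convergent_smoother J n A M \<or> no_smoother J n M"
    and N: "convergent_smoother J n A N \<or> no_smoother J n N" using smoothers by blast+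
  have spd: "spd (A j)" if "j \<le> J" for j
    using A_dim A_spd P_dim' P_rank' galerkin' that by (rule spd_galerkin_levels)
  interpret multigrid J n A P M N
    using A_dim spd P_dim' smoother_carrier[OF M] smoother_carrier[OF N] galerkin'
    by (rule multigrid.intro)
  note a = A_dim[OF order_refl] A_spd[OF order_refl] and a0 = A_dim[OF le0] A_spd[OF le0]
  have n0: "n 0 > 0" and nJ: "n J > 0" by (simp_all add: n)
  note S_dim = smoothed_prolongation_carrier[OF order_refl, folded S]
  note E_dim = error_propagation_matrix(1)[folded E]
  have x_dim: "x \<in> carrier_vec (n J)"
    unfolding x by (rule mult_mat_vec_carrier[OF spd_inverse(1)[OF a] b])
  have S_le: "op_norm (A 0) (A J) S \<le> 1"
  proof (rule op_norm_le[OF a0 S_dim n0])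
    fix v :: "real vec" assume v: "v \<in> carrier_vec (n 0)"
    have "energy_norm (A J) (S *\<^sub>v v) \<le> energy_norm (A 0) v"
      unfolding S
      by (rule energy_norm_smoothed_prolongation_le[OF
            smoother_energy_norm_le[OF N _ A_dim spd] order_refl v])
    thus "energy_norm (A J) (S *\<^sub>v v) \<le> 1 * energy_norm (A 0) v" by simp
  qed
  note deviation = inexact_vcycle_deviation[OF b _ _ n0, folded S x]
  note error = inexact_vcycle_error[OF b _ _ n0, folded S E x]
  have quotient: "energy_norm (A J) (vcycle n A P M N (exact_solver A) J b y - vcycle n A P M N sol J b y)
      / energy_norm (A J) (x - y) \<le> op_norm (A 0) (A J) S * \<gamma>"
    if y: "y \<in> carrier_vec (n J)" "y \<noteq> x" and sol: "sol \<in> carrier_vec (n 0) \<rightarrow> carrier_vec (n 0)"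
      and bound: "coarse_error_bound J n A P M b sol \<gamma> y" for y sol \<gamma>
  proof -
    \<comment> \<open>Needed for a positive denominator: in HOL a quotient by zero would be
      0.\<close>
    have "x - y \<noteq> 0\<^sub>v (n J)"
    proof
      assume eq: "x - y = 0\<^sub>v (n J)"
      have "y = x - (x - y)" using x_dim y(1) by (intro eq_vecI) auto
      also have "\<dots> = x" unfolding eq using x_dim by simp
      finally show False using y(2) by contradiction
    qed
    hence "energy_norm (A J) (x - y) > 0"
      by (rule energy_norm_pos[OF a minus_carrier_vec[OF x_dim y(1)]])
    thus ?thesis using deviation[OF y(1) sol bound] by (simp add: pos_divide_le_eq)
  qed
  have conv: "(\<lambda>k. eucl_norm (x - inV_iterates J n A P M N b sol x0 k)) \<longlonglongrightarrow> 0"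
    if pos: "\<gamma> > 0"
      and sol: "\<And>k y. y \<in> carrier_vec (n J) \<Longrightarrow> sol k y \<in> carrier_vec (n 0) \<rightarrow> carrier_vec (n 0)"
      and bound: "\<And>k y. y \<in> carrier_vec (n J) \<Longrightarrow> coarse_error_bound J n A P M b (sol k y) \<gamma> y"
      and less: "op_norm (A J) (A J) E + op_norm (A 0) (A J) S * \<gamma> < 1"
      and x0: "x0 \<in> carrier_vec (n J)" for sol \<gamma> x0
  proof -
    \<comment> \<open>The contraction factor, the same in every iteration because \<gamma> is. Its
      nonnegativity is needed to iterate the estimate and for its powers to tend to 0.\<close>
    define \<rho> where "\<rho> = op_norm (A J) (A J) E + op_norm (A 0) (A J) S * \<gamma>"
    have \<rho>: "0 \<le> \<rho>" "\<rho> < 1"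
      using op_norm_nonneg[OF a a E_dim nJ] op_norm_nonneg[OF a0 a S_dim n0] pos less
      by (simp_all add: \<rho>_def)
    define it where "it = inV_iterates J n A P M N b sol x0"
    have it_Suc: "it (Suc k) = vcycle n A P M N (sol k (it k)) J b (it k)" for k
      by (simp add: it_def Let_def)
    \<comment> \<open>The assumptions on \<open>sol k y\<close> hold for y of the right dimension,
      so dimensions are settled before the decay is iterated.\<close>
    have it_dim: "it k \<in> carrier_vec (n J)" for k
    proof (induction k)
      case 0
      show ?case using x0 by (simp add: it_def)
    next
      case (Suc k)
      show ?case unfolding it_Suc by (rule vcycle_carrier[OF order_refl sol[OF Suc.IH] b Suc.IH])
    qed
    have decay: "energy_norm (A J) (x - it k) \<le> \<rho> ^ k * energy_norm (A J) (x - x0)" for k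
    proof (induction k)
      case 0
      show ?case by (simp add: it_def)
    next
      case (Suc k)
      have "energy_norm (A J) (x - it (Suc k)) \<le> \<rho> * energy_norm (A J) (x - it k)"
        unfolding it_Suc \<rho>_def by (rule error[OF it_dim sol[OF it_dim] bound[OF it_dim]])
      also have "\<dots> \<le> \<rho> * (\<rho> ^ k * energy_norm (A J) (x - x0))"
        by (rule mult_left_mono[OF Suc.IH \<rho>(1)])
      finally show ?case by (simp add: mult.assoc)
    qed
    \<comment> \<open>The decay is in the energy norm, while convergence is stated in the Euclidean
      norm; K translates between them.\<close>
    obtain K where K: "K \<ge> 0" "\<And>v. v \<in> carrier_vec (n J) \<Longrightarrow> eucl_norm v \<le> K * energy_norm (A J) v"
      using eucl_norm_le_energy_norm[OF a] by blast
    have upper: "eucl_norm (x - it k) \<le> K * (\<rho> ^ k * energy_norm (A J) (x - x0))" for k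
      by (rule order_trans[OF K(2)[OF minus_carrier_vec[OF x_dim it_dim]] mult_left_mono[OF decay K(1)]])
    have "(\<lambda>k. K * (\<rho> ^ k * energy_norm (A J) (x - x0))) \<longlonglongrightarrow> K * (0 * energy_norm (A J) (x - x0))"
      using \<rho> by (intro tendsto_intros LIMSEQ_realpow_zero)
    hence "(\<lambda>k. K * (\<rho> ^ k * energy_norm (A J) (x - x0))) \<longlonglongrightarrow> 0" by simp
    thus ?thesis unfolding it_def[symmetric]
      by (rule tendsto_sandwich[OF always_eventually always_eventually tendsto_const, rotated 2])
        (use eucl_norm_nonneg upper in auto)
  qed
  show ?thesis
    unfolding Let_def
    by (intro conjI ballI allI impI S_le)
      (blast intro: quotient error conv)+
qed

end
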